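(* For the 1-parameter family of cocycles with $\theta_A=\theta_B=-\frac12\theta$, the quantisation $\mathbb{C}_F[\mathbb{CP}^3]$ has exactly the projection relations $a+b+c+d=1$, \[ a(1-a)=X+Y+Z,\quad X-U=ab-cd,\quad Y-V=ac-bd,\quad Z-W=ad-bc, \] \[ au=y^*z,\quad av=x^*z,\quad aw=x^*y,\quad bu=w^*v,\quad cv=wu,\quad dw=vu^*, \] \[ cx=yw^*,\quad by=xw,\quad bz=xv,\quad dx=zv^*,\quad dy=zu^*,\quad cz=yu, \] and the quantisation $\mathbb{C}^-_F[\mathbb{CP}^3]$ has these with, in addition, the relations $X=ab$, $Y=ac$, $Z=ad$ (hence $U=cd$, $V=bd$, $W=bc$); but now with the commutation relations \[ xz=e^{\imath\theta}zx,\quad yx=e^{\imath\theta}xy,\quad yz=e^{\imath\theta}zy, \] and the auxiliary commutation relations \[ uv=e^{\imath\theta}vu,\quad uw=e^{\imath\theta}wu,\quad vw=e^{\imath\theta}wv, \] \[ x(u,v,w)=(e^{2\imath\theta}u,e^{\imath\theta}v,e^{-\imath\theta}w)x, \] \[ y(u,v,w)=(e^{\imath\theta}u,v,e^{-\imath\theta}w)y,\quad z(u,v,w)=(e^{\imath\theta}u,e^{\imath\theta}v,w)z, \] and similar relations with inverse factor if any generator in a relation is replaced by its adjoint under $*$.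
   Context: $\mathbb{C}[\mathbb{CP}^3]$ is the commutative unital $*$-algebra generated by the entries $Q^\mu{}_\nu$ ($\mu,\nu=1,\dots,4$) with relations $Q^2=Q$, $\mathrm{Tr}\,Q=1$ and $(Q^\mu{}_\nu)^*=Q^\nu{}_\mu$. $\mathbb{C}^-[\mathbb{CP}^3]$ is its quotient by the relations $Q^2{}_1Q^1{}_2=Q^1{}_1Q^2{}_2$, $Q^3{}_1Q^1{}_3=Q^1{}_1Q^3{}_3$, $Q^4{}_1Q^1{}_4=Q^1{}_1Q^4{}_4$ (the relations $X=ab,Y=ac,Z=ad$ in the notation below). Let $(\theta_{\mu\nu})$ be a real antisymmetric $4\times4$ matrix with all rows and columns summing to zero, and put $\theta_A=\theta_{12}+\theta_{23}+\theta_{31}$, $\theta_B=\theta_{23}+\theta_{34}+\theta_{42}$, $\theta=\theta_{13}-\theta_{23}+\theta_{24}-\theta_{14}$. Both algebras are graded by monomials in $t_1^{\pm1},\dots,t_4^{\pm1}$ modulo $t_1t_2t_3t_4=1$, with $Q^\mu{}_\nu$ of weight $t_\mu t_\nu^{-1}$; $\mathbb{C}_F[\mathbb{CP}^3]$ and $\mathbb{C}_F^-[\mathbb{CP}^3]$ are the same vector spaces with the same $*$ and twisted product $f\bullet g=F(\mathrm{wt}f,\mathrm{wt}g)fg$ on homogeneous elements, $F(t^{\vec a},t^{\vec b})=e^{\imath\sum a_\mu\theta_{\mu\nu}b_\nu}$. The generators are $\hat Q^\mu{}_\nu=e^{-\imath\theta_{\mu\nu}}Q^\mu{}_\nu$,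 named by \[ \hat Q=\begin{pmatrix} a & x & y & z \\ x^* & b & w & v \\ y^* & w^* & c & u \\ z^* & v^* & u^* & d \end{pmatrix},\qquad a,b,c,d\ \text{self-adjoint}, \] and $X=x^*x$, $Y=y^*y$, $Z=z^*z$, $U=u^*u$, $V=v^*v$, $W=w^*w$. All products in the claim are the twisted product. In addition $a,b,c,d$ are central and every entry commutes with its own adjoint. The notation $x(u,v,w)=(\lambda u,\mu v,\nu w)x$ means $xu=\lambda ux$, $xv=\mu vx$, $xw=\nu wx$. "Inverse factor": if $pq=\lambda qp$ then $pq^*=\lambda^{-1}q^*p$. *)

theory Defs
  imports
    "HOL-Analysis.Analysis"
    "HOL-Algebra.QuotRing"
    "HOL-Algebra.Module"
    "HOL-Library.Poly_Mapping"
begin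

text \<open>Unital \<open>*\<close>-algebras over the complex numbers, not necessarily commutative.\<close>

record 'a star_algebra = "(complex, 'a) module" +
  star :: "'a \<Rightarrow> 'a"

definition star_alg_iso :: "'a star_algebra \<Rightarrow> 'b star_algebra \<Rightarrow> ('a \<Rightarrow> 'b) set"
  where "star_alg_iso A B =
    {\<phi> \<in> ring_iso A B.
      (\<forall>c. \<forall>f \<in> carrier A. \<phi> (c \<odot>\<^bsub>A\<^esub> f) = c \<odot>\<^bsub>B\<^esub> \<phi> f) \<and>
      (\<forall>f \<in> carrier A. \<phi> (star A f) = star B (\<phi> f))}"

text \<open>The two-sided ideal generated by \<open>S\<close> and its adjoints is the smallest
  \<open>*\<close>-ideal containing \<open>S\<close>.\<close>

definition star_ideal :: "'a star_algebra \<Rightarrow> 'a set \<Rightarrow> 'a set"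
  where "star_ideal A S = genideal A (S \<union> star A ` S)"

text \<open>The quotient of \<open>A\<close> by the relations \<open>r = 0\<close> for \<open>r \<in> S\<close>. The scalar multiple
  of a coset is written as a union, as in \<^const>\<open>rcoset_mult\<close>, since
  the elementwise multiple of a coset by \<open>0\<close> is not a coset.\<close>

definition quot_by :: "'a star_algebra \<Rightarrow> 'a set \<Rightarrow> 'a set star_algebra"
  where "quot_by A S =
    (let I = star_ideal A S in
     \<lparr>carrier = carrier (A Quot I), mult = mult (A Quot I), one = one (A Quot I),
      zero = zero (A Quot I), add = add (A Quot I),
      smult = (\<lambda>c X. \<Union>f\<in>X. I +>\<^bsub>A\<^esub> (c \<odot>\<^bsub>A\<^esub> f)),
      star = (\<lambda>X. star A ` X)\<rparr>)"

definition quot_class :: "'a star_algebra \<Rightarrow> 'a set \<Rightarrow> 'a \<Rightarrow> 'a set"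
  where "quot_class A S f = star_ideal A S +>\<^bsub>A\<^esub> f"


section \<open>The free \<open>*\<close>-algebra on the entries of a \<open>4 \<times> 4\<close> matrix\<close>

text \<open>Words, i.e. the free monoid, written additively because the product
  of \<open>_ \<Rightarrow>\<^sub>0 _\<close> is convolution over addition of keys. The numeral type \<open>4\<close> has the
  four elements \<open>1, 2, 3, 4\<close> (with \<open>4 = 0\<close>).\<close>

datatype 'a word = Word (letters: "'a list")

instantiation word :: (type) monoid_add
begin

definition zero_word :: "'a word" where "0 = Word []"

definition plus_word :: "'a word \<Rightarrow> 'a word \<Rightarrow> 'a word"
  where "v + w = Word (letters v @ letters w)"

instance
  by standard (simp_all add: zero_word_def plus_word_def)

end

type_synonym free = "(4 \<times> 4) word \<Rightarrow>\<^sub>0 complex"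

definition gen :: "4 \<Rightarrow> 4 \<Rightarrow> free"
  where "gen \<mu> \<nu> = Poly_Mapping.single (Word [(\<mu>, \<nu>)]) 1"

definition scal :: "complex \<Rightarrow> free \<Rightarrow> free"  (infixr "*\<^sub>C" 75)
  where "c *\<^sub>C p = Poly_Mapping.single 0 c * p"

text \<open>The antilinear antimultiplicative involution with
  \<open>(gen \<mu> \<nu>)\<^sup>\<star> = gen \<nu> \<mu>\<close>.\<close>

definition free_star :: "free \<Rightarrow> free"  ("_\<^sup>\<star>" [1000] 999)
  where "p\<^sup>\<star> = (\<Sum>w\<in>Poly_Mapping.keys p.
    Poly_Mapping.single (Word (rev (map prod.swap (letters w)))) (cnj (Poly_Mapping.lookup p w)))"

lemma free_star_gen: "(gen \<mu> \<nu>)\<^sup>\<star> = gen \<nu> \<mu>"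
  by (simp add: free_star_def gen_def)

definition Free :: "free star_algebra"
  where "Free = \<lparr>carrier = UNIV, mult = (*), one = 1, zero = 0, add = (+),
                 smult = scal, star = free_star\<rparr>"

text \<open>\<open>A\<close> is the unital \<open>*\<close>-algebra with generators the matrix \<open>q\<close>, where
  \<open>(q \<mu> \<nu>)\<^sup>* = q \<nu> \<mu>\<close>, and exactly the relations \<open>r = 0\<close> for \<open>r \<in> S\<close>.\<close>

definition has_presentation :: "'a star_algebra \<Rightarrow> (4 \<Rightarrow> 4 \<Rightarrow> 'a) \<Rightarrow> free set \<Rightarrow> bool"
  where "has_presentation A q S \<longleftrightarrow>
    (\<exists>\<phi> \<in> star_alg_iso (quot_by Free S) A. \<forall>\<mu> \<nu>. \<phi> (quot_class Free S (gen \<mu> \<nu>)) = q \<mu> \<nu>)"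


section \<open>The algebras \<open>\<complex>[CP\<^sup>3]\<close> and \<open>\<complex>\<^sup>-[CP\<^sup>3]\<close>\<close>

definition CP3_rels :: "free set"
  where "CP3_rels =
    {gen \<mu> \<nu> * gen \<rho> \<sigma> - gen \<rho> \<sigma> * gen \<mu> \<nu> | \<mu> \<nu> \<rho> \<sigma>. True} \<union>
    {(\<Sum>\<rho>\<in>UNIV. gen \<mu> \<rho> * gen \<rho> \<nu>) - gen \<mu> \<nu> | \<mu> \<nu>. True} \<union>
    {(\<Sum>\<mu>\<in>UNIV. gen \<mu> \<mu>) - 1}"

definition CP3 :: "free set star_algebra"
  where "CP3 = quot_by Free CP3_rels"

definition Q :: "4 \<Rightarrow> 4 \<Rightarrow> free set"
  where "Q \<mu> \<nu> = quot_class Free CP3_rels (gen \<mu> \<nu>)"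

definition CP3_minus_rels :: "free set set"
  where "CP3_minus_rels =
    {Q 2 1 \<otimes>\<^bsub>CP3\<^esub> Q 1 2 \<ominus>\<^bsub>CP3\<^esub> Q 1 1 \<otimes>\<^bsub>CP3\<^esub> Q 2 2,
     Q 3 1 \<otimes>\<^bsub>CP3\<^esub> Q 1 3 \<ominus>\<^bsub>CP3\<^esub> Q 1 1 \<otimes>\<^bsub>CP3\<^esub> Q 3 3,
     Q 4 1 \<otimes>\<^bsub>CP3\<^esub> Q 1 4 \<ominus>\<^bsub>CP3\<^esub> Q 1 1 \<otimes>\<^bsub>CP3\<^esub> Q 4 4}"

definition CP3_minus :: "free set set star_algebra"
  where "CP3_minus = quot_by CP3 CP3_minus_rels"

definition Q_minus :: "4 \<Rightarrow> 4 \<Rightarrow> free set set"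
  where "Q_minus \<mu> \<nu> = quot_class CP3 CP3_minus_rels (Q \<mu> \<nu>)"


section \<open>Grading and cocycle twist\<close>

text \<open>Monomials in \<open>t\<^sub>1\<^sup>\<plusminus>\<^sup>1, \<dots>, t\<^sub>4\<^sup>\<plusminus>\<^sup>1\<close> modulo \<open>t\<^sub>1t\<^sub>2t\<^sub>3t\<^sub>4 = 1\<close>,
  given by their exponent vectors up to adding multiples of \<open>(1,1,1,1)\<close>.\<close>

quotient_type tmon = "int ^ 4" / "\<lambda>a b. \<exists>k. \<forall>\<mu>. a $ \<mu> - b $ \<mu> = k"
  morphisms rep_tmon tmon
proof (rule equivpI)
  show "reflp (\<lambda>a b :: int ^ 4. \<exists>k. \<forall>\<mu>. a $ \<mu> - b $ \<mu> = k)"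
    by (auto simp: reflp_def)
  show "symp (\<lambda>a b :: int ^ 4. \<exists>k. \<forall>\<mu>. a $ \<mu> - b $ \<mu> = k)"
    by (intro sympI) (metis minus_diff_eq)
  show "transp (\<lambda>a b :: int ^ 4. \<exists>k. \<forall>\<mu>. a $ \<mu> - b $ \<mu> = k)"
  proof (rule transpI)
    fix a b c :: "int ^ 4"
    assume "\<exists>k. \<forall>\<mu>. a $ \<mu> - b $ \<mu> = k" "\<exists>k. \<forall>\<mu>. b $ \<mu> - c $ \<mu> = k"
    then obtain k l where "\<And>\<mu>. a $ \<mu> - b $ \<mu> = k" "\<And>\<mu>. b $ \<mu> - c $ \<mu> = l"
      by blast
    then have "\<forall>\<mu>. a $ \<mu> - c $ \<mu> = k + l"
      by (metis diff_add_cancel add_diff_eq)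
    then show "\<exists>k. \<forall>\<mu>. a $ \<mu> - c $ \<mu> = k" by blast
  qed
qed

definition weight :: "(4 \<times> 4) word \<Rightarrow> tmon"
  where "weight w = tmon (\<Sum>(\<mu>, \<nu>)\<leftarrow>letters w. axis \<mu> 1 - axis \<nu> 1)"

text \<open>A grading is given by its homogeneous subspaces.\<close>

definition Free_grading :: "tmon \<Rightarrow> free set"
  where "Free_grading \<alpha> = {p. \<forall>w \<in> Poly_Mapping.keys p. weight w = \<alpha>}"

definition CP3_grading :: "tmon \<Rightarrow> free set set"
  where "CP3_grading \<alpha> = quot_class Free CP3_rels ` Free_grading \<alpha>"

definition CP3_minus_grading :: "tmon \<Rightarrow> free set set set"
  where "CP3_minus_grading \<alpha> = quot_class CP3 CP3_minus_rels ` CP3_grading \<alpha>"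

definition graded_decomp ::
  "'a star_algebra \<Rightarrow> (tmon \<Rightarrow> 'a set) \<Rightarrow> 'a \<Rightarrow> tmon set \<Rightarrow> (tmon \<Rightarrow> 'a) \<Rightarrow> bool"
  where "graded_decomp A Gr f S c \<longleftrightarrow>
    finite S \<and> (\<forall>\<alpha>\<in>S. c \<alpha> \<in> Gr \<alpha>) \<and> f = (\<Oplus>\<^bsub>A\<^esub>\<alpha>\<in>S. c \<alpha>)"

text \<open>The biadditive extension of \<open>f \<bullet> g = F (wt f) (wt g) f g\<close> from homogeneous elements.\<close>

definition twisted_mult ::
  "(tmon \<Rightarrow> tmon \<Rightarrow> complex) \<Rightarrow> 'a star_algebra \<Rightarrow> (tmon \<Rightarrow> 'a set) \<Rightarrow> 'a \<Rightarrow> 'a \<Rightarrow> 'a"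
  where "twisted_mult F A Gr f g =
    (THE h. \<exists>S c T d. graded_decomp A Gr f S c \<and> graded_decomp A Gr g T d \<and>
       h = (\<Oplus>\<^bsub>A\<^esub>\<alpha>\<in>S. \<Oplus>\<^bsub>A\<^esub>\<beta>\<in>T. F \<alpha> \<beta> \<odot>\<^bsub>A\<^esub> (c \<alpha> \<otimes>\<^bsub>A\<^esub> d \<beta>)))"

definition twist ::
  "(tmon \<Rightarrow> tmon \<Rightarrow> complex) \<Rightarrow> 'a star_algebra \<Rightarrow> (tmon \<Rightarrow> 'a set) \<Rightarrow> 'a star_algebra"
  where "twist F A Gr = A\<lparr>mult := twisted_mult F A Gr\<rparr>"

text \<open>The cocycle is evaluated on representatives; by the lemma below the choice is
  immaterial when all rows and columns of \<open>\<Theta>\<close> sum to zero.\<close>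

definition cocycle :: "real ^ 4 ^ 4 \<Rightarrow> tmon \<Rightarrow> tmon \<Rightarrow> complex"
  where "cocycle \<Theta> \<alpha> \<beta> =
    exp (\<i> * complex_of_real (\<Sum>\<mu>\<in>UNIV. \<Sum>\<nu>\<in>UNIV.
      of_int (rep_tmon \<alpha> $ \<mu>) * \<Theta> $ \<mu> $ \<nu> * of_int (rep_tmon \<beta> $ \<nu>)))"

lemma cocycle_tmon:
  assumes rows: "\<And>\<mu>. (\<Sum>\<nu>\<in>UNIV. \<Theta> $ \<mu> $ \<nu>) = 0"
    and cols: "\<And>\<nu>. (\<Sum>\<mu>\<in>UNIV. \<Theta> $ \<mu> $ \<nu>) = 0"
  shows "cocycle \<Theta> (tmon a) (tmon b) =
    exp (\<i> * complex_of_real (\<Sum>\<mu>\<in>UNIV. \<Sum>\<nu>\<in>UNIV.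
      of_int (a $ \<mu>) * \<Theta> $ \<mu> $ \<nu> * of_int (b $ \<nu>)))"
proof -
  have rep: "\<exists>k. \<forall>\<mu>. a $ \<mu> = rep_tmon (tmon a) $ \<mu> + k" for a
  proof -
    have "\<exists>k. \<forall>\<mu>. a $ \<mu> - rep_tmon (tmon a) $ \<mu> = k"
      using Quotient3_rep_abs[OF Quotient3_tmon, of a] 
        equivp_symp[OF tmon_equivp] equivp_reflp[OF tmon_equivp] by blast
    then show ?thesis by (metis add.commute diff_add_cancel)
  qed
  obtain k l where k: "\<And>\<mu>. a $ \<mu> = rep_tmon (tmon a) $ \<mu> + k"
    and l: "\<And>\<mu>. b $ \<mu> = rep_tmon (tmon b) $ \<mu> + l"
    using rep by meson
  define a' where "a' = (\<lambda>\<mu>. real_of_int (rep_tmon (tmon a) $ \<mu>))"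
  define b' where "b' = (\<lambda>\<mu>. real_of_int (rep_tmon (tmon b) $ \<mu>))"
  have "(\<Sum>\<mu>\<in>UNIV. \<Sum>\<nu>\<in>UNIV. of_int (a $ \<mu>) * \<Theta> $ \<mu> $ \<nu> * of_int (b $ \<nu>)) =
    (\<Sum>\<mu>\<in>UNIV. \<Sum>\<nu>\<in>UNIV. (a' \<mu> + of_int k) * \<Theta> $ \<mu> $ \<nu> * (b' \<nu> + of_int l))"
    by (simp add: k l a'_def b'_def)
  also have "\<dots> = (\<Sum>\<mu>\<in>UNIV. \<Sum>\<nu>\<in>UNIV. (a' \<mu> + of_int k) * \<Theta> $ \<mu> $ \<nu> * b' \<nu>) +
    (\<Sum>\<mu>\<in>UNIV. (a' \<mu> + of_int k) * of_int l * (\<Sum>\<nu>\<in>UNIV. \<Theta> $ \<mu> $ \<nu>))"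
    by (simp add: sum.distrib sum_distrib_left sum_distrib_right algebra_simps)
  also have "\<dots> = (\<Sum>\<nu>\<in>UNIV. \<Sum>\<mu>\<in>UNIV. (a' \<mu> + of_int k) * \<Theta> $ \<mu> $ \<nu> * b' \<nu>)"
    by (simp add: rows) (rule sum.swap)
  also have "\<dots> = (\<Sum>\<nu>\<in>UNIV. \<Sum>\<mu>\<in>UNIV. a' \<mu> * \<Theta> $ \<mu> $ \<nu> * b' \<nu>) +
    (\<Sum>\<nu>\<in>UNIV. of_int k * b' \<nu> * (\<Sum>\<mu>\<in>UNIV. \<Theta> $ \<mu> $ \<nu>))"
    by (simp add: sum.distrib sum_distrib_left sum_distrib_right algebra_simps)
  also have "\<dots> = (\<Sum>\<mu>\<in>UNIV. \<Sum>\<nu>\<in>UNIV. a' \<mu> * \<Theta> $ \<mu> $ \<nu> * b' \<nu>)"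
    by (simp add: cols) (rule sum.swap)
  finally show ?thesis
    by (simp add: cocycle_def a'_def b'_def)
qed

definition CP3_F :: "real ^ 4 ^ 4 \<Rightarrow> free set star_algebra"
  where "CP3_F \<Theta> = twist (cocycle \<Theta>) CP3 CP3_grading"

definition Qhat :: "real ^ 4 ^ 4 \<Rightarrow> 4 \<Rightarrow> 4 \<Rightarrow> free set"
  where "Qhat \<Theta> \<mu> \<nu> = exp (- \<i> * complex_of_real (\<Theta> $ \<mu> $ \<nu>)) \<odot>\<^bsub>CP3_F \<Theta>\<^esub> Q \<mu> \<nu>"

definition CP3_minus_F :: "real ^ 4 ^ 4 \<Rightarrow> free set set star_algebra"
  where "CP3_minus_F \<Theta> = twist (cocycle \<Theta>) CP3_minus CP3_minus_grading"

definition Qhat_minus :: "real ^ 4 ^ 4 \<Rightarrow> 4 \<Rightarrow> 4 \<Rightarrow> free set set"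
  where "Qhat_minus \<Theta> \<mu> \<nu> =
    exp (- \<i> * complex_of_real (\<Theta> $ \<mu> $ \<nu>)) \<odot>\<^bsub>CP3_minus_F \<Theta>\<^esub> Q_minus \<mu> \<nu>"

definition theta_A :: "real ^ 4 ^ 4 \<Rightarrow> real"
  where "theta_A \<Theta> = \<Theta> $ 1 $ 2 + \<Theta> $ 2 $ 3 + \<Theta> $ 3 $ 1"

definition theta_B :: "real ^ 4 ^ 4 \<Rightarrow> real"
  where "theta_B \<Theta> = \<Theta> $ 2 $ 3 + \<Theta> $ 3 $ 4 + \<Theta> $ 4 $ 2"

definition theta :: "real ^ 4 ^ 4 \<Rightarrow> real"
  where "theta \<Theta> = \<Theta> $ 1 $ 3 - \<Theta> $ 2 $ 3 + \<Theta> $ 2 $ 4 - \<Theta> $ 1 $ 4"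


section \<open>The relations of the quantised algebras\<close>

text \<open>Each relation \<open>l = r\<close> is given by the element \<open>l - r\<close> of the free \<open>*\<close>-algebra.
  The entries of the matrix of generators are
  \<open>(a, x, y, z; x\<^sup>\<star>, b, w, v; y\<^sup>\<star>, w\<^sup>\<star>, c, u; z\<^sup>\<star>, v\<^sup>\<star>, u\<^sup>\<star>, d)\<close>.\<close>

definition projection_rels :: "free set"
  where "projection_rels =
    (let a = gen 1 1; b = gen 2 2; c = gen 3 3; d = gen 4 4;
         x = gen 1 2; y = gen 1 3; z = gen 1 4; w = gen 2 3; v = gen 2 4; u = gen 3 4;
         X = x\<^sup>\<star> * x; Y = y\<^sup>\<star> * y; Z = z\<^sup>\<star> * z; U = u\<^sup>\<star> * u; V = v\<^sup>\<star> * v; W = w\<^sup>\<star> * w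
     in {a + b + c + d - 1,
         a * (1 - a) - (X + Y + Z),
         X - U - (a * b - c * d), Y - V - (a * c - b * d), Z - W - (a * d - b * c),
         a * u - y\<^sup>\<star> * z, a * v - x\<^sup>\<star> * z, a * w - x\<^sup>\<star> * y,
         b * u - w\<^sup>\<star> * v, c * v - w * u, d * w - v * u\<^sup>\<star>,
         c * x - y * w\<^sup>\<star>, b * y - x * w, b * z - x * v,
         d * x - z * v\<^sup>\<star>, d * y - z * u\<^sup>\<star>, c * z - y * u})"

definition minus_rels :: "free set"
  where "minus_rels =
    (let a = gen 1 1; b = gen 2 2; c = gen 3 3; d = gen 4 4;
         x = gen 1 2; y = gen 1 3; z = gen 1 4;
         X = x\<^sup>\<star> * x; Y = y\<^sup>\<star> * y; Z = z\<^sup>\<star> * z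
     in {X - a * b, Y - a * c, Z - a * d})"

text \<open>\<open>p q = \<kappa> q p\<close> together with the relations obtained by replacing one or both of
  \<open>p, q\<close> by the adjoint, each replacement inverting the factor.\<close>

definition comm_rels :: "complex \<Rightarrow> free \<Rightarrow> free \<Rightarrow> free set"
  where "comm_rels \<kappa> p q =
    {p * q - \<kappa> *\<^sub>C (q * p),
     p * q\<^sup>\<star> - inverse \<kappa> *\<^sub>C (q\<^sup>\<star> * p),
     p\<^sup>\<star> * q - inverse \<kappa> *\<^sub>C (q * p\<^sup>\<star>),
     p\<^sup>\<star> * q\<^sup>\<star> - \<kappa> *\<^sub>C (q\<^sup>\<star> * p\<^sup>\<star>)}"

definition commutation_rels :: "real \<Rightarrow> free set"
  where "commutation_rels \<theta> =
    (let x = gen 1 2; y = gen 1 3; z = gen 1 4; w = gen 2 3; v = gen 2 4; u = gen 3 4;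
         e = exp (\<i> * complex_of_real \<theta>)
     in {gen \<mu> \<mu> * gen \<rho> \<sigma> - gen \<rho> \<sigma> * gen \<mu> \<mu> | \<mu> \<rho> \<sigma>. True} \<union>
        {gen \<mu> \<nu> * (gen \<mu> \<nu>)\<^sup>\<star> - (gen \<mu> \<nu>)\<^sup>\<star> * gen \<mu> \<nu> | \<mu> \<nu>. True} \<union>
        comm_rels e x z \<union> comm_rels e y x \<union> comm_rels e y z \<union>
        comm_rels e u v \<union> comm_rels e u w \<union> comm_rels e v w \<union>
        comm_rels (e ^ 2) x u \<union> comm_rels e x v \<union> comm_rels (inverse e) x w \<union>
        comm_rels e y u \<union> comm_rels 1 y v \<union> comm_rels (inverse e) y w \<union>
        comm_rels e z u \<union> comm_rels e z v \<union> comm_rels 1 z w)"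

end

theory Submission
  imports Defs
begin

text \<open>
  Pulled back to the free monoid of words, the cocycle becomes a coboundary: scaling
  every word by a suitable phase is a \<open>*\<close>-isomorphism of the free algebra onto its twist by the cocycle. Since all
  relations are homogeneous, this scaling maps the ideal of the twisted commutation relations and
  projection relations onto the classical ideal, so that it induces the isomorphism of the
  presented algebra with the twist of the quotient. All relations other than
  the commutation relations are merely multiplied by a phase, because
  \<open>Q\<^sup>\<mu>\<^sub>\<rho> Q\<^sup>\<rho>\<^sub>\<nu>\<close> acquires a phase independent of \<open>\<rho>\<close>. What remains is that the
  \<open>2 \<times> 2\<close> minors of an idempotent \<open>4 \<times> 4\<close> matrix of trace one over a commutative ring
  without 2- and 3-torsion vanish.
\<close>

section \<open>Idempotent matrices of trace one\<close>

text \<open>Coboundaries on an abelian group are symmetric, so a genuine twist is not a coboundary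
  on the grading group. On words it becomes one because the order of the letters is still visible:
  the phase is built letter by letter from the bilinear exponent, and the normalisation of
  \<open>Qhat\<close> is its value on single letters. The two inclusions between the ideals differ
  in nature. That the classical ideal contains relations such as \<open>a u = y^* z\<close> is not a
  linear consequence of idempotence and trace one; this is where the vanishing of minors enters. The
  converse is linear algebra, but has to be carried out inside the twisted algebra, where
  off-diagonal entries commute only up to phases. It uses no commutation except that of diagonal
  entries with everything and of each entry with its adjoint, and these carry no phase. The
  conditions on \<open>theta_A\<close> and \<open>theta_B\<close> fix the numerical factors of the
  remaining commutation relations.\<close>

definition minor2 :: "(4 \<Rightarrow> 4 \<Rightarrow> 'a::comm_ring) \<Rightarrow> 4 \<Rightarrow> 4 \<Rightarrow> 4 \<Rightarrow> 4 \<Rightarrow> 'a"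
  where "minor2 q i j a b = q i a * q j b - q i b * q j a"

text \<open>The expansion along the last row, arranged so that the last column takes the place of
  the removed one. All correction terms then carry the same minus sign, and in the trace over last
  row and last column each of them contracts one column slot with \<open>q\<close>.\<close>

definition minor3 :: "(4 \<Rightarrow> 4 \<Rightarrow> 'a::comm_ring) \<Rightarrow> 4 \<Rightarrow> 4 \<Rightarrow> 4 \<Rightarrow> 4 \<Rightarrow> 4 \<Rightarrow> 4 \<Rightarrow> 'a"
  where "minor3 q i j k a b c =
    q k c * minor2 q i j a b - q k a * minor2 q i j c b - q k b * minor2 q i j a c"

definition minor4 ::
  "(4 \<Rightarrow> 4 \<Rightarrow> 'a::comm_ring) \<Rightarrow> 4 \<Rightarrow> 4 \<Rightarrow> 4 \<Rightarrow> 4 \<Rightarrow> 4 \<Rightarrow> 4 \<Rightarrow> 4 \<Rightarrow> 4 \<Rightarrow> 'a"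
  where "minor4 q i j k l a b c d = q l d * minor3 q i j k a b c -
    q l a * minor3 q i j k d b c - q l b * minor3 q i j k a d c - q l c * minor3 q i j k a b d"

definition minor5 ::
  "(4 \<Rightarrow> 4 \<Rightarrow> 'a::comm_ring) \<Rightarrow> 4 \<Rightarrow> 4 \<Rightarrow> 4 \<Rightarrow> 4 \<Rightarrow> 4 \<Rightarrow> 4 \<Rightarrow> 4 \<Rightarrow> 4 \<Rightarrow> 4 \<Rightarrow> 4 \<Rightarrow> 'a"
  where "minor5 q i j k l m a b c d e = q m e * minor4 q i j k l a b c d -
    q m a * minor4 q i j k l e b c d - q m b * minor4 q i j k l a e c d -
    q m c * minor4 q i j k l a b e d - q m d * minor4 q i j k l a b c e"

lemma minor2_alt:
  "minor2 q i j a a = 0" "minor2 q i j b a = - minor2 q i j a b"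
  by (simp_all add: minor2_def mult.commute)

lemma minor3_alt:
  "minor3 q i j k a a c = 0" "minor3 q i j k a b a = 0" "minor3 q i j k a b b = 0"
  "minor3 q i j k b a c = - minor3 q i j k a b c"
  "minor3 q i j k c b a = - minor3 q i j k a b c"
  "minor3 q i j k a c b = - minor3 q i j k a b c"
  "minor3 q i j k b c a = minor3 q i j k a b c"
  "minor3 q i j k c a b = minor3 q i j k a b c"
  using minor2_alt(2)[of q i j a b] minor2_alt(2)[of q i j a c] minor2_alt(2)[of q i j b c]
  by (simp_all add: minor3_def minor2_alt(1))

lemma minor4_alt:
  "minor4 q i j k l a a c d = 0" "minor4 q i j k l a b a d = 0" "minor4 q i j k l a b c a = 0"
  "minor4 q i j k l a b b d = 0" "minor4 q i j k l a b c b = 0" "minor4 q i j k l a b c c = 0"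
  "minor4 q i j k l b a c d = - minor4 q i j k l a b c d"
  "minor4 q i j k l c b a d = - minor4 q i j k l a b c d"
  "minor4 q i j k l d b c a = - minor4 q i j k l a b c d"
  "minor4 q i j k l a c b d = - minor4 q i j k l a b c d"
  "minor4 q i j k l a d c b = - minor4 q i j k l a b c d"
  "minor4 q i j k l a b d c = - minor4 q i j k l a b c d"
  by (simp_all add: minor4_def minor3_alt(1-3)
      minor3_alt(4-8)[where a = a and b = b and c = c]
      minor3_alt(4-8)[where a = a and b = b and c = d]
      minor3_alt(4-8)[where a = a and b = c and c = d]
      minor3_alt(4-8)[where a = b and b = c and c = d])

text \<open>By pigeonhole two of the five columns coincide. If one of them is \<open>e\<close>, the
  leading term cancels against one correction term; otherwise two correction terms cancel by
  antisymmetry. All other terms have a repeated column.\<close>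

lemma minor5_eq_0: "minor5 q i j k l m a b c d e = 0"
proof -
  have "card {a, b, c, d, e} \<le> 4"
    using card_mono[of "UNIV :: 4 set" "{a, b, c, d, e}"] by simp
  then consider "a = b" | "a = c" | "a = d" | "b = c" | "b = d" | "c = d"
    | "e = a" | "e = b" | "e = c" | "e = d"
    by (auto simp: card_insert_if split: if_splits)
  then show ?thesis
    using minor4_alt(7)[of q i j k l e a c d] minor4_alt(8)[of q i j k l e b a d]
      minor4_alt(9)[of q i j k l e b c a] minor4_alt(10)[of q i j k l a e b d]
      minor4_alt(11)[of q i j k l a e c b] minor4_alt(12)[of q i j k l a b e c]
    by cases (simp_all add: minor5_def minor4_alt(1-6))
qed

text \<open>The partial trace of \<open>\<Lambda>\<^sup>k\<^sup>+\<^sup>1 q\<close> of an idempotent is \<open>(Tr q - k) \<Lambda>\<^sup>k q\<close>. As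
  \<open>\<Lambda>\<^sup>5 q = 0\<close> in dimension four, trace one forces \<open>\<Lambda>\<^sup>4 q\<close>, \<open>\<Lambda>\<^sup>3 q\<close> and \<open>\<Lambda>\<^sup>2 q\<close> to vanish in turn.\<close>

lemma trace_one_idempotent_minor:
  fixes q :: "4 \<Rightarrow> 4 \<Rightarrow> 'a::comm_ring"
  assumes idem: "\<And>\<mu> \<nu>. (\<Sum>\<rho>\<in>UNIV. q \<mu> \<rho> * q \<rho> \<nu>) = q \<mu> \<nu>"
    and trace: "\<And>x. (\<Sum>\<mu>\<in>UNIV. q \<mu> \<mu>) * x = x"
    and two: "\<And>x::'a. x + x = 0 \<Longrightarrow> x = 0" and three: "\<And>x::'a. x + x + x = 0 \<Longrightarrow> x = 0"
  shows "q i a * q j b = q i b * q j a"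
proof -
  \<comment> \<open>A minor is linear in each column, so contracting a column slot with
    \<open>q\<close> replaces that column of \<open>q\<close> by the one of
    \<open>q^2 = q\<close>.\<close>
  have s2: "(\<Sum>m\<in>UNIV. q m a * minor2 q i j m b) = minor2 q i j a b" for i j a b
  proof -
    have "(\<Sum>m\<in>UNIV. q m a * minor2 q i j m b) =
      (\<Sum>m\<in>UNIV. q i m * q m a) * q j b - q i b * (\<Sum>m\<in>UNIV. q j m * q m a)"
      by (simp add: minor2_def sum_distrib_right sum_distrib_left sum_subtractf sum.distrib algebra_simps)
    then show ?thesis by (simp add: idem minor2_def)
  qed
  have s3: "(\<Sum>m\<in>UNIV. q m a * minor3 q i j k m b c) = minor3 q i j k a b c" for i j k a b c
  proof -
    have "(\<Sum>m\<in>UNIV. q m a * minor3 q i j k m b c) =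
      q k c * (\<Sum>m\<in>UNIV. q m a * minor2 q i j m b) -
      (\<Sum>m\<in>UNIV. q k m * q m a) * minor2 q i j c b -
      q k b * (\<Sum>m\<in>UNIV. q m a * minor2 q i j m c)"
      by (simp add: minor3_def sum_distrib_right sum_distrib_left sum_subtractf sum.distrib algebra_simps)
    then show ?thesis by (simp add: idem s2 minor3_def)
  qed
  have s4: "(\<Sum>m\<in>UNIV. q m a * minor4 q i j k l m b c d) = minor4 q i j k l a b c d"
    for i j k l a b c d
  proof -
    have "(\<Sum>m\<in>UNIV. q m a * minor4 q i j k l m b c d) =
      q l d * (\<Sum>m\<in>UNIV. q m a * minor3 q i j k m b c) -
      (\<Sum>m\<in>UNIV. q l m * q m a) * minor3 q i j k d b c -
      q l b * (\<Sum>m\<in>UNIV. q m a * minor3 q i j k m d c) -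
      q l c * (\<Sum>m\<in>UNIV. q m a * minor3 q i j k m b d)"
      by (simp add: minor4_def sum_distrib_right sum_distrib_left sum_subtractf sum.distrib algebra_simps)
    then show ?thesis by (simp add: idem s3 minor4_def)
  qed
  \<comment> \<open>The other column slots are moved to the first one by antisymmetry.\<close>
  have s3': "(\<Sum>m\<in>UNIV. q m b * minor2 q i j a m) = minor2 q i j a b" for i j a b
    by (simp add: minor2_alt(2)[of q i j a] sum_negf s2)
  have s4': "(\<Sum>m\<in>UNIV. q m b * minor3 q i j k a m c) = minor3 q i j k a b c" for i j k a b c
    by (simp add: minor3_alt(4)[of q i j k a _ c] sum_negf s3)
  have s4'': "(\<Sum>m\<in>UNIV. q m c * minor3 q i j k a b m) = minor3 q i j k a b c" for i j k a b c
    by (simp add: minor3_alt(5)[of q i j k a b] sum_negf s3)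
  have s5': "(\<Sum>m\<in>UNIV. q m b * minor4 q i j k l a m c d) = minor4 q i j k l a b c d"
    for i j k l a b c d
    by (simp add: minor4_alt(7)[of q i j k l a _ c d] sum_negf s4)
  have s5'': "(\<Sum>m\<in>UNIV. q m c * minor4 q i j k l a b m d) = minor4 q i j k l a b c d"
    for i j k l a b c d
    by (simp add: minor4_alt(8)[of q i j k l a b _ d] sum_negf s4)
  have s5''': "(\<Sum>m\<in>UNIV. q m d * minor4 q i j k l a b c m) = minor4 q i j k l a b c d"
    for i j k l a b c d
    by (simp add: minor4_alt(9)[of q i j k l a b c] sum_negf s4)
  have L: "minor4 q i j k l a b c d = 0" for i j k l a b c d
  proof -
    \<comment> \<open>The factors of the three descents are 1 - 4 = -3, 1 - 3 = -2 and 1 - 2 = -1,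
      whence the assumptions on 3- and 2-torsion.\<close>
    have "0 = (\<Sum>m\<in>UNIV. minor5 q i j k l m a b c d m)"
      by (simp add: minor5_eq_0)
    also have "\<dots> = (\<Sum>m\<in>UNIV. q m m) * minor4 q i j k l a b c d -
        (minor4 q i j k l a b c d + minor4 q i j k l a b c d + minor4 q i j k l a b c d +
          minor4 q i j k l a b c d)"
      by (simp add: minor5_def sum_subtractf s4 s5' s5'' s5''' flip: sum_distrib_right)
    also have "\<dots> = - (minor4 q i j k l a b c d + minor4 q i j k l a b c d + minor4 q i j k l a b c d)"
      by (simp only: trace) simp
    finally have "minor4 q i j k l a b c d + minor4 q i j k l a b c d + minor4 q i j k l a b c d = 0"
      by (simp only: neg_0_equal_iff_equal)
    then show ?thesis by (rule three)
  qed
  have N: "minor3 q i j k a b c = 0" for i j k a b c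
  proof -
    have "0 = (\<Sum>m\<in>UNIV. minor4 q i j k m a b c m)"
      by (simp add: L)
    also have "\<dots> = (\<Sum>m\<in>UNIV. q m m) * minor3 q i j k a b c -
        (minor3 q i j k a b c + minor3 q i j k a b c + minor3 q i j k a b c)"
      by (simp add: minor4_def sum_subtractf s3 s4' s4'' flip: sum_distrib_right)
    also have "\<dots> = - (minor3 q i j k a b c + minor3 q i j k a b c)"
      by (simp only: trace) simp
    finally have "minor3 q i j k a b c + minor3 q i j k a b c = 0"
      by (simp only: neg_0_equal_iff_equal)
    then show ?thesis by (rule two)
  qed
  have "0 = (\<Sum>m\<in>UNIV. minor3 q i j m a b m)"
    by (simp add: N)
  also have "\<dots> = (\<Sum>m\<in>UNIV. q m m) * minor2 q i j a b - (minor2 q i j a b + minor2 q i j a b)"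
    by (simp add: minor3_def sum_subtractf s2 s3' flip: sum_distrib_right)
  also have "\<dots> = - minor2 q i j a b"
    by (simp only: trace) simp
  finally show ?thesis by (simp add: minor2_def)
qed

section \<open>Ideals of the free \<open>*\<close>-algebra\<close>

lemma Free_simps [simp]:
  "carrier Free = UNIV" "mult Free = (*)" "one Free = 1" "zero Free = 0" "add Free = (+)"
  "smult Free = scal" "star Free = free_star"
  by (simp_all add: Free_def)

lemma ring_Free: "ring Free"
proof (rule ringI)
  show "abelian_group Free"
    by (rule abelian_groupI) (auto simp: algebra_simps intro: exI[of _ "- _"] left_minus)
  show "Group.monoid Free"
    by (rule monoidI) (simp_all add: mult.assoc)
qed (simp_all add: algebra_simps)

interpretation Free: ring Free
  by (rule ring_Free)

lemma a_inv_Free [simp]: "a_inv Free p = - p"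
  by (rule Free.minus_equality) simp_all

lemma ideal_Free_iff:
  "ideal I Free \<longleftrightarrow> 0 \<in> I \<and> (\<forall>p\<in>I. \<forall>q\<in>I. p + q \<in> I) \<and> (\<forall>p\<in>I. \<forall>q. q * p \<in> I \<and> p * q \<in> I)"
  (is "_ \<longleftrightarrow> ?R")
proof
  assume "ideal I Free"
  then interpret ideal I Free .
  show ?R
    using additive_subgroup.zero_closed[OF is_additive_subgroup] a_closed I_l_closed I_r_closed
    by simp
next
  assume R: ?R
  have "- p \<in> I" if "p \<in> I" for p
    using R that by (metis mult_1 mult_minus_left)
  moreover have "m_inv (add_monoid Free) p = - p" for p
    using a_inv_Free[of p] by (simp only: a_inv_def)
  ultimately have "subgroup I (add_monoid Free)"
    using R by unfold_locales auto
  then show "ideal I Free"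
    using R by (intro idealI ring_Free) auto
qed

abbreviation Idl_Free :: "free set \<Rightarrow> free set"
  where "Idl_Free G \<equiv> genideal Free G"

lemma ideal_Idl_Free: "ideal (Idl_Free G) Free"
  by (rule Free.genideal_ideal) simp

lemma Idl_Free_gen: "g \<in> G \<Longrightarrow> g \<in> Idl_Free G"
  using Free.genideal_self[of G] by auto

lemma Idl_Free_least: "ideal I Free \<Longrightarrow> G \<subseteq> I \<Longrightarrow> Idl_Free G \<subseteq> I"
  by (rule Free.genideal_minimal)

lemma Idl_Free_mono: "(\<And>g. g \<in> G \<Longrightarrow> g \<in> Idl_Free H) \<Longrightarrow> Idl_Free G \<subseteq> Idl_Free H"
  by (intro Idl_Free_least ideal_Idl_Free) auto

context
  fixes I :: "free set"
  assumes I: "ideal I Free"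
begin

lemma Free_ideal_closed:
  "0 \<in> I" "p \<in> I \<Longrightarrow> q \<in> I \<Longrightarrow> p + q \<in> I"
  "p \<in> I \<Longrightarrow> r * p \<in> I" "p \<in> I \<Longrightarrow> p * r \<in> I" "p \<in> I \<Longrightarrow> c *\<^sub>C p \<in> I"
  using I by (auto simp: ideal_Free_iff scal_def)

lemma Free_ideal_uminus: "p \<in> I \<Longrightarrow> - p \<in> I"
  using Free_ideal_closed(3)[of p "-1"] by simp

lemma Free_ideal_diff: "p \<in> I \<Longrightarrow> q \<in> I \<Longrightarrow> p - q \<in> I"
  using Free_ideal_closed(2)[of p "- q"] Free_ideal_uminus by simp

lemma Free_ideal_sum: "(\<And>x. x \<in> A \<Longrightarrow> f x \<in> I) \<Longrightarrow> sum f A \<in> I"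
  by (induction A rule: infinite_finite_induct) (auto intro: Free_ideal_closed)

lemma Free_ideal_sym: "p - q \<in> I \<Longrightarrow> q - p \<in> I"
  using Free_ideal_uminus[of "p - q"] by simp

lemma Free_ideal_trans: "p - q \<in> I \<Longrightarrow> q - r \<in> I \<Longrightarrow> p - r \<in> I"
  using Free_ideal_closed(2)[of "p - q" "q - r"] by simp

lemma Free_ideal_add_cong: "p - p' \<in> I \<Longrightarrow> q - q' \<in> I \<Longrightarrow> p + q - (p' + q') \<in> I"
  using Free_ideal_closed(2)[of "p - p'" "q - q'"] by (simp add: algebra_simps)

lemma Free_ideal_mult_cong: "p - p' \<in> I \<Longrightarrow> q - q' \<in> I \<Longrightarrow> p * q - p' * q' \<in> I"
  using Free_ideal_closed(2)[OF Free_ideal_closed(4)[of "p - p'" q] Free_ideal_closed(3)[of "q - q'" p']]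
  by (simp add: algebra_simps)

end

lemma poly_mapping_sum_single:
  "p = (\<Sum>w\<in>Poly_Mapping.keys p. Poly_Mapping.single w (Poly_Mapping.lookup p w))"
  by (rule poly_mapping_eqI) (simp add: lookup_sum lookup_single when_def in_keys_iff)

text \<open>An ideal element is a finite sum of generators multiplied by monomials on both sides.
  Scalars are central, so one coefficient, kept on the left, suffices. Monomial multiples matter
  because the phase scaling is controlled only on homogeneous factors.\<close>

lemma Idl_Free_induct [consumes 1, case_names zero add gen]:
  assumes "p \<in> Idl_Free G"
    and zero: "P 0" and add: "\<And>p q. P p \<Longrightarrow> P q \<Longrightarrow> P (p + q)"
    and gen: "\<And>v w c g. g \<in> G \<Longrightarrow> P (Poly_Mapping.single v c * g * Poly_Mapping.single w 1)"
  shows "P p"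
proof -
  \<comment> \<open>Requiring \<open>P\<close> for all two-sided multiples as well turns
    \<open>P\<close> into an ideal.\<close>
  define H where "H = {f. P f \<and> (\<forall>l r. P (l * f * r))}"
  have sum: "P (sum f A)" if "\<And>x. x \<in> A \<Longrightarrow> P (f x)" for f :: "_ \<Rightarrow> free" and A :: "(4 \<times> 4) word set"
    using that by (induction A rule: infinite_finite_induct) (auto intro: zero add)
  have g: "P (l * g * r)" if "g \<in> G" for l r g
  proof -
    have "P (l * g * Poly_Mapping.single w c)" for w c
    proof -
      have c: "f * Poly_Mapping.single w c = f * Poly_Mapping.single 0 c * Poly_Mapping.single w 1" for f :: free
        by (simp add: mult.assoc mult_single)
      have z: "Poly_Mapping.single v d * g * Poly_Mapping.single 0 c =
         Poly_Mapping.single v (d * c) * g" for v d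
      proof -
        have "g * Poly_Mapping.single 0 c = Poly_Mapping.single 0 c * g"
          by (subst (1 2) poly_mapping_sum_single[of g])
            (simp add: sum_distrib_left sum_distrib_right mult_single mult.commute)
        then show ?thesis by (simp add: mult.assoc) (simp add: mult_single flip: mult.assoc)
      qed
      show ?thesis
        using gen[OF that]
        by (subst poly_mapping_sum_single[of l], subst c) (auto simp: sum_distrib_right z intro: sum)
    qed
    then show ?thesis
      by (subst poly_mapping_sum_single[of r]) (auto simp: sum_distrib_left intro: sum)
  qed
  have "ideal H Free"
    unfolding ideal_Free_iff H_def
  proof (intro conjI ballI allI)
    show "0 \<in> {f. P f \<and> (\<forall>l r. P (l * f * r))}" using zero by simp
  next
    fix p q assume "p \<in> {f. P f \<and> (\<forall>l r. P (l * f * r))}" "q \<in> {f. P f \<and> (\<forall>l r. P (l * f * r))}"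
    then show "p + q \<in> {f. P f \<and> (\<forall>l r. P (l * f * r))}"
      by (simp add: add distrib_left distrib_right)
  next
    fix p q assume p: "p \<in> {f. P f \<and> (\<forall>l r. P (l * f * r))}"
    then have P: "P (l * p * r)" for l r by blast
    show "q * p \<in> {f. P f \<and> (\<forall>l r. P (l * f * r))}"
      using P[of q 1] P[of "_ * q"] by (simp add: mult.assoc)
    show "p * q \<in> {f. P f \<and> (\<forall>l r. P (l * f * r))}"
      using P[of 1 q] P[of _ "q * _"] by (simp add: mult.assoc)
  qed
  moreover have "G \<subseteq> H"
    using g g[where l = 1 and r = 1] by (auto simp: H_def)
  ultimately show ?thesis
    using Idl_Free_least[of H G] assms(1) by (auto simp: H_def)
qed

lemma Idl_Free_empty: "Idl_Free {} = {0}"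
  using Idl_Free_least[of "{0}" "{}"] Free_ideal_closed(1)[OF ideal_Idl_Free]
  by (auto simp: ideal_Free_iff)

lemma Idl_Free_Un_absorb: "Idl_Free (Idl_Free G \<union> H) = Idl_Free (G \<union> H)"
proof (rule antisym)
  have "Idl_Free G \<subseteq> Idl_Free (G \<union> H)"
    by (rule Idl_Free_mono) (auto intro: Idl_Free_gen)
  then show "Idl_Free (Idl_Free G \<union> H) \<subseteq> Idl_Free (G \<union> H)"
    by (intro Idl_Free_least ideal_Idl_Free) (auto intro: Idl_Free_gen)
  show "Idl_Free (G \<union> H) \<subseteq> Idl_Free (Idl_Free G \<union> H)"
    by (rule Idl_Free_mono) (auto intro: Idl_Free_gen)
qed

section \<open>Scalars and involution on the free algebra\<close>

lemma scal_simps: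
  "c *\<^sub>C (p + q) = c *\<^sub>C p + c *\<^sub>C q" "c *\<^sub>C (p - q) = c *\<^sub>C p - c *\<^sub>C q"
  "(c *\<^sub>C p) * q = c *\<^sub>C (p * q)" "c *\<^sub>C d *\<^sub>C p = (c * d) *\<^sub>C p" "1 *\<^sub>C p = p"
  "c *\<^sub>C 0 = 0"
  by (simp_all add: scal_def distrib_left right_diff_distrib mult.assoc)
     (simp add: mult_single flip: mult.assoc)

lemma scal_single: "c *\<^sub>C Poly_Mapping.single w d = Poly_Mapping.single w (c * d)"
  by (simp add: scal_def mult_single)

lemma lookup_scal: "Poly_Mapping.lookup (c *\<^sub>C p) w = c * Poly_Mapping.lookup p w"
  by (subst poly_mapping_sum_single[of p])
    (simp add: scal_def sum_distrib_left mult_single lookup_sum lookup_single when_def in_keys_iff)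

lemma single_0_commute: "p * Poly_Mapping.single 0 c = c *\<^sub>C p" for p :: free
  by (subst (1 2) poly_mapping_sum_single[of p])
    (simp add: scal_def sum_distrib_left sum_distrib_right mult_single mult.commute)

definition word_star :: "(4 \<times> 4) word \<Rightarrow> (4 \<times> 4) word"
  where "word_star w = Word (rev (map prod.swap (letters w)))"

lemma word_star_star [simp]: "word_star (word_star w) = w"
  by (simp add: word_star_def rev_map comp_def)

lemma word_star_plus: "word_star (v + w) = word_star w + word_star v"
  by (simp add: word_star_def plus_word_def)

lemma lookup_star: "Poly_Mapping.lookup (p\<^sup>\<star>) w = cnj (Poly_Mapping.lookup p (word_star w))"
proof -
  have "Poly_Mapping.lookup (p\<^sup>\<star>) w =
    (\<Sum>v\<in>Poly_Mapping.keys p. if v = word_star w then cnj (Poly_Mapping.lookup p v) else 0)"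
    unfolding free_star_def lookup_sum
    by (rule sum.cong) (auto simp: lookup_single when_def simp flip: word_star_def)
  then show ?thesis
    by (simp add: in_keys_iff)
qed

lemma star_add: "(p + q)\<^sup>\<star> = p\<^sup>\<star> + q\<^sup>\<star>"
  and star_diff: "(p - q)\<^sup>\<star> = p\<^sup>\<star> - q\<^sup>\<star>"
  and star_zero: "0\<^sup>\<star> = 0"
  and star_star [simp]: "(p\<^sup>\<star>)\<^sup>\<star> = p"
  by (rule poly_mapping_eqI, simp add: lookup_star lookup_add lookup_minus lookup_scal)+

lemma star_single: "(Poly_Mapping.single w c)\<^sup>\<star> = Poly_Mapping.single (word_star w) (cnj c)"
  by (rule poly_mapping_eqI) (auto simp: lookup_star lookup_single when_def)

lemma star_sum: "(sum f A)\<^sup>\<star> = (\<Sum>x\<in>A. (f x)\<^sup>\<star>)"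
  by (induction A rule: infinite_finite_induct) (auto simp: star_add star_zero)

lemma star_mult: "(p * q)\<^sup>\<star> = q\<^sup>\<star> * p\<^sup>\<star>"
proof -
  have "(Poly_Mapping.single v c * q)\<^sup>\<star> = q\<^sup>\<star> * (Poly_Mapping.single v c)\<^sup>\<star>" for v c
    by (subst (1 2) poly_mapping_sum_single[of q])
      (simp add: sum_distrib_left sum_distrib_right star_sum star_single mult_single word_star_plus
        mult.commute)
  then show ?thesis
    by (subst (1 2) poly_mapping_sum_single[of p])
      (simp add: sum_distrib_left sum_distrib_right star_sum)
qed

lemma ideal_star_ideal: "ideal (star_ideal Free S) Free"
  by (simp add: star_ideal_def ideal_Idl_Free)

lemma Idl_Free_star:
  assumes "p \<in> Idl_Free G" and G: "\<And>g. g \<in> G \<Longrightarrow> g\<^sup>\<star> \<in> Idl_Free G"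
  shows "p\<^sup>\<star> \<in> Idl_Free G"
  using assms(1)
  by (induction rule: Idl_Free_induct)
    (simp_all add: star_zero star_add star_mult G Free_ideal_closed[OF ideal_Idl_Free])

lemma star_ideal_star: "p \<in> star_ideal Free S \<Longrightarrow> p\<^sup>\<star> \<in> star_ideal Free S"
  unfolding star_ideal_def by (rule Idl_Free_star) (auto intro!: Idl_Free_gen)

section \<open>Algebras presented as quotients of the free algebra\<close>

text \<open>An algebra known through representatives in the free algebra, with the kernel
  \<open>K\<close> as its whole content. Quotients enlarge \<open>K\<close>, twists pull it back
  along a phase scaling, and equal kernels give isomorphic algebras; the ring laws of
  \<open>A\<close> are inherited.\<close>

locale free_surj =
  fixes \<psi> :: "free \<Rightarrow> 'a" and A :: "'a star_algebra" and K :: "free set"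
  assumes ideal_K: "ideal K Free"
    and carrier: "carrier A = range \<psi>"
    and eq_iff: "\<psi> p = \<psi> q \<longleftrightarrow> p - q \<in> K"
    and mult: "mult A (\<psi> p) (\<psi> q) = \<psi> (p * q)"
    and add: "add A (\<psi> p) (\<psi> q) = \<psi> (p + q)"
    and one: "one A = \<psi> 1"
    and zero: "zero A = \<psi> 0"
    and smult: "smult A c (\<psi> p) = \<psi> (c *\<^sub>C p)"
    and star: "star A (\<psi> p) = \<psi> (p\<^sup>\<star>)"
begin

lemma ring: "ring A"
proof (rule ringI)
  show "abelian_group A"
  proof (rule abelian_groupI)
    fix x assume "x \<in> carrier A"
    then obtain p where "x = \<psi> p" by (auto simp: carrier)
    then show "\<exists>y\<in>carrier A. y \<oplus>\<^bsub>A\<^esub> x = \<zero>\<^bsub>A\<^esub>"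
      by (intro bexI[of _ "\<psi> (- p)"]) (auto simp: carrier add zero)
  qed (auto simp: carrier add zero algebra_simps)
  show "Group.monoid A"
    by (rule monoidI) (auto simp: carrier mult one mult.assoc)
qed (auto simp: carrier add mult algebra_simps)

sublocale ring A
  by (rule ring)

lemma a_inv: "\<ominus>\<^bsub>A\<^esub> \<psi> p = \<psi> (- p)"
  by (rule minus_equality) (auto simp: carrier add zero)

lemma minus: "\<psi> p \<ominus>\<^bsub>A\<^esub> \<psi> q = \<psi> (p - q)"
  by (simp add: a_minus_def a_inv add)

lemma finsum: "finite S \<Longrightarrow> (\<And>x. x \<in> S \<Longrightarrow> f x = \<psi> (g x)) \<Longrightarrow> (\<Oplus>\<^bsub>A\<^esub>x\<in>S. f x) = \<psi> (sum g S)"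
proof (induction S rule: finite_induct)
  case empty
  then show ?case by (simp add: zero)
next
  case (insert x S)
  then have "f \<in> S \<rightarrow> carrier A" "f x \<in> carrier A"
    by (auto simp: carrier)
  then show ?case
    using insert by (simp add: finsum_insert add)
qed

lemma star_K: "p \<in> K \<Longrightarrow> p\<^sup>\<star> \<in> K"
  using star[of p] star[of 0] eq_iff[of p 0] eq_iff[of "p\<^sup>\<star>" 0] by (simp add: star_zero)

text \<open>The correspondence of ideals under a surjection: the image of the upstairs ideal is an
  ideal containing the relations, and the preimage of the downstairs ideal contains both
  \<open>G\<close> and \<open>R\<close>.\<close>

lemma genideal_iff:
  assumes K: "K = Idl_Free G"
  shows "\<psi> p \<in> genideal A (\<psi> ` R) \<longleftrightarrow> p \<in> Idl_Free (G \<union> R)"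
proof
  let ?H = "\<psi> ` Idl_Free (G \<union> R)"
  note closed = Free_ideal_closed[OF ideal_Idl_Free[of "G \<union> R"]]
    Free_ideal_uminus[OF ideal_Idl_Free[of "G \<union> R"]]
  have "subgroup ?H (add_monoid A)"
  proof (rule add.subgroupI)
    fix x y assume "x \<in> ?H"
    then show "\<ominus>\<^bsub>A\<^esub> x \<in> ?H"
      using closed by (auto simp: a_inv)
    assume "y \<in> ?H"
    then show "x \<oplus>\<^bsub>A\<^esub> y \<in> ?H"
      using \<open>x \<in> ?H\<close> closed by (auto simp: add)
  qed (use closed in \<open>auto simp: carrier\<close>)
  then have "ideal ?H A"
    by (rule idealI[OF ring]) (use closed in \<open>auto simp: carrier mult\<close>)
  moreover have "\<psi> ` R \<subseteq> ?H"
    by (auto intro: Idl_Free_gen)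
  ultimately have "genideal A (\<psi> ` R) \<subseteq> ?H"
    by (rule genideal_minimal)
  moreover assume "\<psi> p \<in> genideal A (\<psi> ` R)"
  ultimately obtain q where q: "\<psi> p = \<psi> q" "q \<in> Idl_Free (G \<union> R)"
    by blast
  moreover have "K \<subseteq> Idl_Free (G \<union> R)"
    unfolding K by (rule Idl_Free_mono) (simp add: Idl_Free_gen)
  ultimately have "p - q \<in> Idl_Free (G \<union> R)"
    by (auto simp: eq_iff)
  then show "p \<in> Idl_Free (G \<union> R)"
    using closed(2)[of "p - q" q] q(2) by simp
next
  have "ideal (genideal A (\<psi> ` R)) A"
    by (rule genideal_ideal) (auto simp: carrier)
  then interpret I: ideal "genideal A (\<psi> ` R)" A .
  have zero_in: "\<psi> 0 \<in> genideal A (\<psi> ` R)"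
    using I.zero_closed by (simp add: zero)
  have "ideal {q. \<psi> q \<in> genideal A (\<psi> ` R)} Free"
    unfolding ideal_Free_iff
    using zero_in I.a_closed I.I_l_closed I.I_r_closed
    by (auto simp: carrier simp flip: add mult)
  moreover have "q \<in> {q. \<psi> q \<in> genideal A (\<psi> ` R)}" if "q \<in> G" for q
  proof -
    have "\<psi> q = \<psi> 0"
      using that by (simp add: eq_iff K Idl_Free_gen)
    then show ?thesis using zero_in by simp
  qed
  moreover have "\<psi> ` R \<subseteq> genideal A (\<psi> ` R)"
    by (rule genideal_self) (auto simp: carrier)
  ultimately have "Idl_Free (G \<union> R) \<subseteq> {q. \<psi> q \<in> genideal A (\<psi> ` R)}"
    by (intro Idl_Free_least) auto
  then show "p \<in> Idl_Free (G \<union> R) \<Longrightarrow> \<psi> p \<in> genideal A (\<psi> ` R)"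
    by auto
qed

text \<open>Successive quotients collapse to a single quotient of the free algebra, which makes the
  two-stage definition of \<open>CP3_minus\<close> comparable with a presentation.\<close>

lemma quot_by:
  assumes K: "K = Idl_Free G" and S: "S = \<psi> ` R"
  shows "free_surj (\<lambda>p. quot_class A S (\<psi> p)) (quot_by A S) (Idl_Free (G \<union> R \<union> free_star ` R))"
proof -
  define I where "I = star_ideal A S"
  define J where "J = Idl_Free (G \<union> R \<union> free_star ` R)"
  have I_eq: "I = genideal A (\<psi> ` (R \<union> free_star ` R))"
    by (simp add: I_def star_ideal_def S image_Un image_image star)
  have I_iff: "\<psi> p \<in> I \<longleftrightarrow> p \<in> J" for p
    unfolding I_eq genideal_iff[OF K] by (simp add: J_def Un_assoc)
  have "ideal I A"
    unfolding I_eq by (rule genideal_ideal) (auto simp: carrier)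
  then interpret I: ideal I A .
  have cls: "quot_class A S (\<psi> p) = I +>\<^bsub>A\<^esub> \<psi> p" for p
    by (simp add: quot_class_def I_def)
  have cls_eq: "I +>\<^bsub>A\<^esub> \<psi> p = I +>\<^bsub>A\<^esub> \<psi> q \<longleftrightarrow> p - q \<in> J" for p q
    using quotient_eq_iff_same_a_r_cos[OF \<open>ideal I A\<close>, of "\<psi> p" "\<psi> q"]
    by (auto simp: carrier minus I_iff)
  have J: "ideal J Free" by (simp add: J_def ideal_Idl_Free)
  \<comment> \<open>The generators \<open>G\<close> are not assumed closed under the involution,
    whereas \<open>K\<close> is closed because the involution of \<open>A\<close> is well defined on
    classes.\<close>
  have J_eq: "J = Idl_Free (K \<union> (R \<union> free_star ` R))"
    by (simp add: J_def K Idl_Free_Un_absorb Un_assoc)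
  have J_star: "p\<^sup>\<star> \<in> J" if "p \<in> J" for p
    using that unfolding J_eq by (rule Idl_Free_star) (auto intro: Idl_Free_gen simp: star_K)
  have mem: "x \<in> I +>\<^bsub>A\<^esub> \<psi> p \<longleftrightarrow> (\<exists>q. x = \<psi> q \<and> p - q \<in> J)" for x p
  proof
    assume "x \<in> I +>\<^bsub>A\<^esub> \<psi> p"
    then obtain h where h: "h \<in> I" "x = h \<oplus>\<^bsub>A\<^esub> \<psi> p" by (auto simp: a_r_coset_def')
    moreover obtain r where "h = \<psi> r"
      using h(1) I.a_subset by (auto simp: carrier)
    ultimately show "\<exists>q. x = \<psi> q \<and> p - q \<in> J"
      using Free_ideal_uminus[OF J, of r] by (auto simp: I_iff add intro!: exI[of _ "r + p"])
  next
    assume "\<exists>q. x = \<psi> q \<and> p - q \<in> J"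
    then obtain q where "x = \<psi> q" "q - p \<in> J" using Free_ideal_sym[OF J] by blast
    then show "x \<in> I +>\<^bsub>A\<^esub> \<psi> p"
      by (auto simp: a_r_coset_def' add I_iff intro!: bexI[of _ "\<psi> (q - p)"])
  qed
  show ?thesis
    unfolding cls J_def[symmetric]
  proof (rule free_surj.intro)
    show "ideal J Free" by (rule J)
    show "carrier (quot_by A S) = range (\<lambda>p. I +>\<^bsub>A\<^esub> \<psi> p)"
      by (auto simp: quot_by_def Let_def I_def[symmetric] FactRing_def A_RCOSETS_def' carrier)
    show "(I +>\<^bsub>A\<^esub> \<psi> p = I +>\<^bsub>A\<^esub> \<psi> q) = (p - q \<in> J)" for p q
      by (rule cls_eq)
    show "mult (quot_by A S) (I +>\<^bsub>A\<^esub> \<psi> p) (I +>\<^bsub>A\<^esub> \<psi> q) = I +>\<^bsub>A\<^esub> \<psi> (p * q)" for p q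
      using I.rcoset_mult_add[of "\<psi> p" "\<psi> q"]
      by (simp add: quot_by_def Let_def I_def[symmetric] FactRing_def carrier mult)
    show "add (quot_by A S) (I +>\<^bsub>A\<^esub> \<psi> p) (I +>\<^bsub>A\<^esub> \<psi> q) = I +>\<^bsub>A\<^esub> \<psi> (p + q)" for p q
      using I.a_rcos_sum[of "\<psi> p" "\<psi> q"]
      by (simp add: quot_by_def Let_def I_def[symmetric] FactRing_def carrier add)
    show "one (quot_by A S) = I +>\<^bsub>A\<^esub> \<psi> 1"
      by (simp add: quot_by_def Let_def I_def[symmetric] FactRing_def one)
    show "zero (quot_by A S) = I +>\<^bsub>A\<^esub> \<psi> 0"
      using I.a_subset Free_ideal_uminus[OF J]
      by (fastforce simp: quot_by_def Let_def I_def[symmetric] FactRing_def mem carrier I_iff)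
    show "smult (quot_by A S) c (I +>\<^bsub>A\<^esub> \<psi> p) = I +>\<^bsub>A\<^esub> \<psi> (c *\<^sub>C p)" for c p
    proof -
      have "(\<Union>f\<in>I +>\<^bsub>A\<^esub> \<psi> p. I +>\<^bsub>A\<^esub> (c \<odot>\<^bsub>A\<^esub> f)) = I +>\<^bsub>A\<^esub> \<psi> (c *\<^sub>C p)"
      proof -
        \<comment> \<open>All cosets in the union coincide, including when the scalar is 0.\<close>
        have "I +>\<^bsub>A\<^esub> (c \<odot>\<^bsub>A\<^esub> f) = I +>\<^bsub>A\<^esub> \<psi> (c *\<^sub>C p)" if f: "f \<in> I +>\<^bsub>A\<^esub> \<psi> p" for f
        proof -
          obtain q where q: "f = \<psi> q" "p - q \<in> J" using f by (auto simp: mem)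
          have "c *\<^sub>C q - c *\<^sub>C p \<in> J"
            using Free_ideal_closed(5)[OF J Free_ideal_sym[OF J q(2)]] by (simp add: scal_simps)
          then show ?thesis by (simp add: q(1) smult cls_eq)
        qed
        moreover have "\<psi> p \<in> I +>\<^bsub>A\<^esub> \<psi> p"
          using Free_ideal_closed(1)[OF J] by (auto simp: mem intro!: exI[of _ p])
        ultimately show ?thesis by (intro SUP_eq_const) auto
      qed
      then show ?thesis by (simp add: quot_by_def Let_def I_def[symmetric])
    qed
    show "star (quot_by A S) (I +>\<^bsub>A\<^esub> \<psi> p) = I +>\<^bsub>A\<^esub> \<psi> (p\<^sup>\<star>)" for p
    proof -
      have "star A ` (I +>\<^bsub>A\<^esub> \<psi> p) = I +>\<^bsub>A\<^esub> \<psi> (p\<^sup>\<star>)"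
      proof (intro equalityI subsetI)
        fix x assume "x \<in> star A ` (I +>\<^bsub>A\<^esub> \<psi> p)"
        then obtain q where q: "x = \<psi> (q\<^sup>\<star>)" "p - q \<in> J" by (auto simp: mem star)
        then show "x \<in> I +>\<^bsub>A\<^esub> \<psi> (p\<^sup>\<star>)"
          using J_star[OF q(2)] by (auto simp: mem star_diff)
      next
        fix x assume "x \<in> I +>\<^bsub>A\<^esub> \<psi> (p\<^sup>\<star>)"
        then obtain q where q: "x = \<psi> q" "p\<^sup>\<star> - q \<in> J" by (auto simp: mem)
        have "\<psi> (q\<^sup>\<star>) \<in> I +>\<^bsub>A\<^esub> \<psi> p"
          using J_star[OF q(2)] by (auto simp: mem star_diff)
        then show "x \<in> star A ` (I +>\<^bsub>A\<^esub> \<psi> p)"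
          by (rule rev_image_eqI) (simp add: q star)
      qed
      then show ?thesis by (simp add: quot_by_def Let_def I_def[symmetric])
    qed
  qed
qed

end

lemma free_surj_id: "free_surj id Free {0}"
  by (rule free_surj.intro) (auto simp: ideal_Free_iff)

lemma free_surj_iso:
  assumes "free_surj \<rho> B K" and "free_surj \<psi> A K"
  shows "\<exists>\<phi>\<in>star_alg_iso B A. \<forall>p. \<phi> (\<rho> p) = \<psi> p"
proof -
  interpret B: free_surj \<rho> B K by fact
  interpret A: free_surj \<psi> A K by fact
  \<comment> \<open>Any representative serves, since both maps have the same kernel.\<close>
  define \<phi> where "\<phi> = (\<lambda>x. \<psi> (SOME p. \<rho> p = x))"
  have \<phi>: "\<phi> (\<rho> p) = \<psi> p" for p
    unfolding \<phi>_def by (rule someI2[of _ p]) (auto simp: A.eq_iff B.eq_iff)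
  have "\<phi> \<in> star_alg_iso B A"
    unfolding star_alg_iso_def ring_iso_def ring_hom_def bij_betw_def inj_on_def
    by (auto simp: A.carrier B.carrier \<phi> A.mult B.mult A.add B.add A.one B.one A.smult B.smult
        A.star B.star A.eq_iff B.eq_iff image_iff)
      (metis diff_self Free_ideal_closed(1)[OF A.ideal_K])+
  then show ?thesis using \<phi> by blast
qed

section \<open>Phase scaling of words and the twisted product\<close>

definition phase_map :: "((4 \<times> 4) word \<Rightarrow> complex) \<Rightarrow> free \<Rightarrow> free"
  where "phase_map \<gamma> p = Poly_Mapping.mapp (\<lambda>w c. \<gamma> w * c) p"

lemma lookup_phase_map: "Poly_Mapping.lookup (phase_map \<gamma> p) w = \<gamma> w * Poly_Mapping.lookup p w"
  by (simp add: phase_map_def lookup_mapp when_def in_keys_iff)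

lemma phase_map_add: "phase_map \<gamma> (p + q) = phase_map \<gamma> p + phase_map \<gamma> q"
  and phase_map_diff: "phase_map \<gamma> (p - q) = phase_map \<gamma> p - phase_map \<gamma> q"
  and phase_map_zero: "phase_map \<gamma> 0 = 0"
  and phase_map_scal: "phase_map \<gamma> (c *\<^sub>C p) = c *\<^sub>C phase_map \<gamma> p"
  by (rule poly_mapping_eqI,
      simp add: lookup_phase_map lookup_add lookup_minus lookup_scal distrib_left right_diff_distrib)+

lemma phase_map_sum: "phase_map \<gamma> (sum f A) = (\<Sum>x\<in>A. phase_map \<gamma> (f x))"
  by (induction A rule: infinite_finite_induct) (auto simp: phase_map_add phase_map_zero)

lemma phase_map_single:
  "phase_map \<gamma> (Poly_Mapping.single w c) = Poly_Mapping.single w (\<gamma> w * c)"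
  by (rule poly_mapping_eqI) (auto simp: lookup_phase_map lookup_single when_def)

lemma phase_map_inverse:
  assumes "\<And>w. \<gamma> w \<noteq> 0"
  shows "phase_map \<gamma> (phase_map (\<lambda>w. inverse (\<gamma> w)) p) = p"
  by (rule poly_mapping_eqI) (simp add: lookup_phase_map assms)

lemma Free_grading_phase_map: "p \<in> Free_grading \<alpha> \<Longrightarrow> phase_map \<gamma> p \<in> Free_grading \<alpha>"
  by (auto simp: Free_grading_def in_keys_iff lookup_phase_map)

lemma phase_map_star:
  assumes "\<And>w. \<gamma> (word_star w) = cnj (\<gamma> w)"
  shows "phase_map \<gamma> (p\<^sup>\<star>) = (phase_map \<gamma> p)\<^sup>\<star>"
  by (rule poly_mapping_eqI) (simp add: lookup_phase_map lookup_star assms)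

text \<open>Word by word the scaling is multiplicative up to \<open>F\<close>; on homogeneous
  factors \<open>F\<close> is constant and comes out as a scalar.\<close>

lemma phase_map_mult_homogeneous:
  assumes p: "p \<in> Free_grading \<alpha>" and q: "q \<in> Free_grading \<beta>"
    and \<gamma>: "\<And>v w. \<gamma> (v + w) = \<gamma> v * \<gamma> w * F (weight v) (weight w)"
  shows "phase_map \<gamma> (p * q) = F \<alpha> \<beta> *\<^sub>C (phase_map \<gamma> p * phase_map \<gamma> q)"
proof -
  have "p * q = (\<Sum>v\<in>Poly_Mapping.keys p. \<Sum>w\<in>Poly_Mapping.keys q.
      Poly_Mapping.single (v + w) (Poly_Mapping.lookup p v * Poly_Mapping.lookup q w))"
    by (subst poly_mapping_sum_single[of p], subst poly_mapping_sum_single[of q])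
      (simp add: sum_product mult_single)
  then have "phase_map \<gamma> (p * q) = (\<Sum>v\<in>Poly_Mapping.keys p. \<Sum>w\<in>Poly_Mapping.keys q.
      F \<alpha> \<beta> *\<^sub>C (phase_map \<gamma> (Poly_Mapping.single v (Poly_Mapping.lookup p v)) *
        phase_map \<gamma> (Poly_Mapping.single w (Poly_Mapping.lookup q w))))"
    using p q
    by (auto simp: phase_map_sum phase_map_single \<gamma> mult_single scal_single Free_grading_def
        ac_simps intro!: sum.cong)
  also have "\<dots> = F \<alpha> \<beta> *\<^sub>C (phase_map \<gamma> p * phase_map \<gamma> q)"
  proof -
    have "phase_map \<gamma> p * phase_map \<gamma> q = (\<Sum>v\<in>Poly_Mapping.keys p. \<Sum>w\<in>Poly_Mapping.keys q.
        phase_map \<gamma> (Poly_Mapping.single v (Poly_Mapping.lookup p v)) *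
        phase_map \<gamma> (Poly_Mapping.single w (Poly_Mapping.lookup q w)))"
      by (subst (1) poly_mapping_sum_single[of p], subst (1) poly_mapping_sum_single[of q])
        (simp only: phase_map_sum sum_product)
    then show ?thesis by (simp add: scal_def sum_distrib_left)
  qed
  finally show ?thesis .
qed

lemma Free_decomp:
  "\<exists>S c. finite S \<and> (\<forall>\<alpha>. c \<alpha> \<in> Free_grading \<alpha>) \<and> p = sum c S"
proof (intro exI conjI allI)
  let ?c = "\<lambda>\<alpha>. \<Sum>w\<in>{w\<in>Poly_Mapping.keys p. weight w = \<alpha>}.
    Poly_Mapping.single w (Poly_Mapping.lookup p w)"
  show "finite (weight ` Poly_Mapping.keys p)" by simp
  show "?c \<alpha> \<in> Free_grading \<alpha>" for \<alpha>
    using keys_sum[of "\<lambda>w. Poly_Mapping.single w (Poly_Mapping.lookup p w)"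
        "{w\<in>Poly_Mapping.keys p. weight w = \<alpha>}"]
    by (fastforce simp: Free_grading_def split: if_splits)
  show "p = sum ?c (weight ` Poly_Mapping.keys p)"
    by (subst poly_mapping_sum_single[of p], rule sum.image_gen) simp
qed

text \<open>The scaling carries the product of the free algebra to its twist, so
  \<open>\<psi>\<close> after the scaling is a surjection onto the twist of \<open>A\<close>, with
  kernel the preimage of \<open>K\<close>. The delicate point is the definite description in
  \<open>twisted_mult\<close>: its value must not depend on the homogeneous decompositions. This
  follows from \<open>J\<close> being an ideal, by lifting the decompositions to the free
  algebra.\<close>

lemma (in free_surj) twist:
  assumes nz: "\<And>w. \<gamma> w \<noteq> 0"
    and \<gamma>0: "\<gamma> 0 = 1" and \<gamma>: "\<And>v w. \<gamma> (v + w) = \<gamma> v * \<gamma> w * F (weight v) (weight w)"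
    and \<gamma>_star: "\<And>w. \<gamma> (word_star w) = cnj (\<gamma> w)"
    and J: "ideal J Free" and J_iff: "\<And>p. p \<in> J \<longleftrightarrow> phase_map \<gamma> p \<in> K"
  shows "free_surj (\<lambda>p. \<psi> (phase_map \<gamma> p)) (twist F A (\<lambda>\<alpha>. \<psi> ` Free_grading \<alpha>)) J"
proof -
  let ?T = "phase_map \<gamma>" and ?Gr = "\<lambda>\<alpha>. \<psi> ` Free_grading \<alpha>"
  have inv: "?T (phase_map (\<lambda>w. inverse (\<gamma> w)) p) = p" for p
    by (rule phase_map_inverse[OF nz])
  \<comment> \<open>Representatives of the components are divided by their phases; this keeps them
    homogeneous, and their sum recovers \<open>p\<close> modulo \<open>J\<close>.\<close>
  have decompE: "\<exists>c'. (\<forall>\<alpha>\<in>S. c' \<alpha> \<in> Free_grading \<alpha> \<and> c \<alpha> = \<psi> (?T (c' \<alpha>))) \<and> sum c' S - p \<in> J"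
    if "graded_decomp A ?Gr (\<psi> (?T p)) S c" for p S c
  proof -
    have S: "finite S" and c: "\<forall>\<alpha>\<in>S. c \<alpha> \<in> ?Gr \<alpha>" and sum: "\<psi> (?T p) = (\<Oplus>\<^bsub>A\<^esub>\<alpha>\<in>S. c \<alpha>)"
      using that by (auto simp: graded_decomp_def)
    have "\<forall>\<alpha>\<in>S. \<exists>r. r \<in> Free_grading \<alpha> \<and> c \<alpha> = \<psi> r"
      using c by blast
    from bchoice[OF this] obtain d where
      d: "\<forall>\<alpha>\<in>S. d \<alpha> \<in> Free_grading \<alpha> \<and> c \<alpha> = \<psi> (d \<alpha>)" ..
    define c' where "c' = (\<lambda>\<alpha>. phase_map (\<lambda>w. inverse (\<gamma> w)) (d \<alpha>))"
    have c': "\<forall>\<alpha>\<in>S. c' \<alpha> \<in> Free_grading \<alpha> \<and> c \<alpha> = \<psi> (?T (c' \<alpha>))"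
      using d by (auto simp: c'_def inv Free_grading_phase_map)
    then have "\<psi> (?T p) = \<psi> (?T (sum c' S))"
      unfolding sum by (simp add: finsum[OF S, of c "\<lambda>\<alpha>. ?T (c' \<alpha>)"] phase_map_sum)
    then have "sum c' S - p \<in> J"
      using eq_iff[of "?T (sum c' S)" "?T p"] by (simp add: J_iff phase_map_diff)
    with c' show ?thesis by blast
  qed
  have mult': "twisted_mult F A ?Gr (\<psi> (?T p)) (\<psi> (?T q)) = \<psi> (?T (p * q))" for p q
    unfolding twisted_mult_def
  proof (rule the_equality)
    obtain S c where c: "finite S" "\<And>\<alpha>. c \<alpha> \<in> Free_grading \<alpha>" "p = sum c S"
      using Free_decomp[of p] by blast
    obtain T d where d: "finite T" "\<And>\<alpha>. d \<alpha> \<in> Free_grading \<alpha>" "q = sum d T"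
      using Free_decomp[of q] by blast
    have "graded_decomp A ?Gr (\<psi> (?T p)) S (\<lambda>\<alpha>. \<psi> (?T (c \<alpha>)))"
      "graded_decomp A ?Gr (\<psi> (?T q)) T (\<lambda>\<alpha>. \<psi> (?T (d \<alpha>)))"
      using c d unfolding graded_decomp_def
      by (auto simp: finsum[OF c(1) refl] finsum[OF d(1) refl] phase_map_sum
          intro!: imageI Free_grading_phase_map)
    moreover have "?T (c \<alpha> * d \<beta>) = F \<alpha> \<beta> *\<^sub>C (?T (c \<alpha>) * ?T (d \<beta>))" for \<alpha> \<beta>
      by (rule phase_map_mult_homogeneous[where \<gamma> = \<gamma> and F = F, OF c(2) d(2) \<gamma>])
    then have "\<psi> (?T (p * q)) = (\<Oplus>\<^bsub>A\<^esub>\<alpha>\<in>S. \<Oplus>\<^bsub>A\<^esub>\<beta>\<in>T. F \<alpha> \<beta> \<odot>\<^bsub>A\<^esub> (\<psi> (?T (c \<alpha>)) \<otimes>\<^bsub>A\<^esub> \<psi> (?T (d \<beta>))))"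
      using c(1,3) d(1,3) by (simp add: mult smult finsum[OF _ refl] sum_product phase_map_sum)
    ultimately show "\<exists>S c T d. graded_decomp A ?Gr (\<psi> (?T p)) S c \<and> graded_decomp A ?Gr (\<psi> (?T q)) T d \<and>
      \<psi> (?T (p * q)) = (\<Oplus>\<^bsub>A\<^esub>\<alpha>\<in>S. \<Oplus>\<^bsub>A\<^esub>\<beta>\<in>T. F \<alpha> \<beta> \<odot>\<^bsub>A\<^esub> (c \<alpha> \<otimes>\<^bsub>A\<^esub> d \<beta>))"
      by blast
  next
    fix h
    assume "\<exists>S c T d. graded_decomp A ?Gr (\<psi> (?T p)) S c \<and> graded_decomp A ?Gr (\<psi> (?T q)) T d \<and>
      h = (\<Oplus>\<^bsub>A\<^esub>\<alpha>\<in>S. \<Oplus>\<^bsub>A\<^esub>\<beta>\<in>T. F \<alpha> \<beta> \<odot>\<^bsub>A\<^esub> (c \<alpha> \<otimes>\<^bsub>A\<^esub> d \<beta>))"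
    then obtain S c T d where dec: "graded_decomp A ?Gr (\<psi> (?T p)) S c" "graded_decomp A ?Gr (\<psi> (?T q)) T d"
      and h: "h = (\<Oplus>\<^bsub>A\<^esub>\<alpha>\<in>S. \<Oplus>\<^bsub>A\<^esub>\<beta>\<in>T. F \<alpha> \<beta> \<odot>\<^bsub>A\<^esub> (c \<alpha> \<otimes>\<^bsub>A\<^esub> d \<beta>))"
      by blast
    obtain c' where c': "\<And>\<alpha>. \<alpha> \<in> S \<Longrightarrow> c' \<alpha> \<in> Free_grading \<alpha>" "\<And>\<alpha>. \<alpha> \<in> S \<Longrightarrow> c \<alpha> = \<psi> (?T (c' \<alpha>))"
      "sum c' S - p \<in> J"
      using decompE[OF dec(1)] by blast
    obtain d' where d': "\<And>\<beta>. \<beta> \<in> T \<Longrightarrow> d' \<beta> \<in> Free_grading \<beta>" "\<And>\<beta>. \<beta> \<in> T \<Longrightarrow> d \<beta> = \<psi> (?T (d' \<beta>))"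
      "sum d' T - q \<in> J"
      using decompE[OF dec(2)] by blast
    have fin: "finite S" "finite T" using dec by (auto simp: graded_decomp_def)
    have "?T (c' \<alpha> * d' \<beta>) = F \<alpha> \<beta> *\<^sub>C (?T (c' \<alpha>) * ?T (d' \<beta>))" if "\<alpha> \<in> S" "\<beta> \<in> T" for \<alpha> \<beta>
      by (rule phase_map_mult_homogeneous[where \<gamma> = \<gamma> and F = F, OF c'(1)[OF that(1)] d'(1)[OF that(2)] \<gamma>])
    then have "h = \<psi> (?T (sum c' S * sum d' T))"
      unfolding h sum_product phase_map_sum
      by (intro finsum fin) (simp add: c'(2) d'(2) mult smult)
    \<comment> \<open>The lifted sums differ from \<open>p\<close> and \<open>q\<close> by elements
      of \<open>J\<close>, hence so do the products.\<close>
    also have "\<dots> = \<psi> (?T (p * q))"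
      using Free_ideal_mult_cong[OF J c'(3) d'(3)]
      by (simp add: eq_iff J_iff phase_map_diff)
    finally show "h = \<psi> (?T (p * q))" .
  qed
  show ?thesis
  proof (rule free_surj.intro)
    show "carrier (twist F A ?Gr) = range (\<lambda>p. \<psi> (?T p))"
      unfolding twist_def using inv by (auto simp: carrier) (metis rangeI)
    show "one (twist F A ?Gr) = \<psi> (?T 1)"
      using phase_map_single[of \<gamma> 0 1] by (simp add: twist_def one \<gamma>0)
  qed (auto simp: twist_def J mult' add zero smult star eq_iff J_iff phase_map_diff phase_map_add
      phase_map_zero phase_map_scal phase_map_star[where \<gamma> = \<gamma>, OF \<gamma>_star])
qed

lemma free_surj_quot: "free_surj (quot_class Free S) (quot_by Free S) (star_ideal Free S)"
  using free_surj.quot_by[OF free_surj_id Idl_Free_empty[symmetric], of S S]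
  by (simp add: star_ideal_def)

lemma free_surj_has_presentation:
  assumes "free_surj \<psi> A (star_ideal Free S)"
  shows "has_presentation A (\<lambda>\<mu> \<nu>. \<psi> (gen \<mu> \<nu>)) S"
  unfolding has_presentation_def using free_surj_iso[OF free_surj_quot assms] by blast

section \<open>The cocycle on words\<close>

definition wvec :: "(4 \<times> 4) list \<Rightarrow> int ^ 4"
  where "wvec l = (\<Sum>(\<mu>, \<nu>)\<leftarrow>l. axis \<mu> 1 - axis \<nu> 1)"

text \<open>Homogeneity for exponent vectors in Z^4, before passing to monomials modulo
  \<open>t1 t2 t3 t4 = 1\<close>. The relations are homogeneous already in this finer sense, so
  weights can be added as vectors without choosing representatives.\<close>

definition homog :: "int ^ 4 \<Rightarrow> free \<Rightarrow> bool"
  where "homog a p \<longleftrightarrow> (\<forall>w\<in>Poly_Mapping.keys p. wvec (letters w) = a)"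

lemma wvec_simps [simp]:
  "wvec [] = 0" "wvec ((\<mu>, \<nu>) # l) = axis \<mu> 1 - axis \<nu> 1 + wvec l"
  "wvec (l @ m) = wvec l + wvec m" "wvec (rev (map prod.swap l)) = - wvec l"
  by (simp_all add: wvec_def) (induction l; auto)

lemma letters_plus [simp]: "letters (v + w) = letters v @ letters w" "letters 0 = []"
  by (simp_all add: plus_word_def zero_word_def)

lemma weight_wvec: "weight w = tmon (wvec (letters w))"
  by (simp add: weight_def wvec_def)

lemma homog_Free_grading: "homog a p \<Longrightarrow> p \<in> Free_grading (tmon a)"
  by (auto simp: homog_def Free_grading_def weight_wvec)

lemma homog_add: "homog a p \<Longrightarrow> homog a q \<Longrightarrow> homog a (p + q)"
  using keys_add[of p q] by (auto simp: homog_def)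

lemma homog_diff: "homog a p \<Longrightarrow> homog a q \<Longrightarrow> homog a (p - q)"
  by (fastforce simp: homog_def in_keys_iff lookup_minus)

lemma homog_scal: "homog a p \<Longrightarrow> homog a (c *\<^sub>C p)"
  by (auto simp: homog_def in_keys_iff lookup_scal)

lemma homog_mult: "homog a p \<Longrightarrow> homog b q \<Longrightarrow> homog (a + b) (p * q)"
  using keys_mult[of p q] by (fastforce simp: homog_def)

lemma homog_single: "homog (wvec (letters w)) (Poly_Mapping.single w c)"
  by (simp add: homog_def)

lemma homog_one: "homog 0 1"
  by (simp add: homog_def)

lemma homog_gen: "homog (axis \<mu> 1 - axis \<nu> 1) (gen \<mu> \<nu>)"
  by (simp add: homog_def gen_def)

lemma homog_star: "homog a p \<Longrightarrow> homog (- a) (p\<^sup>\<star>)"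
proof -
  assume a: "homog a p"
  have "wvec (letters w) = - a" if "w \<in> Poly_Mapping.keys (p\<^sup>\<star>)" for w
  proof -
    have "word_star w \<in> Poly_Mapping.keys p"
      using that by (simp add: in_keys_iff lookup_star)
    then have "wvec (letters (word_star w)) = a" using a by (simp add: homog_def)
    then show ?thesis by (simp add: word_star_def minus_equation_iff)
  qed
  then show ?thesis by (simp add: homog_def)
qed

text \<open>The scaling is not multiplicative, but on a homogeneous generator between two monomials
  it errs only by scalars, which an ideal absorbs. So the inclusion need be checked only on
  generators.\<close>

lemma phase_map_Idl_Free:
  assumes \<gamma>: "\<And>v w. \<gamma> (v + w) = \<gamma> v * \<gamma> w * F (weight v) (weight w)"
    and G: "\<And>g. g \<in> G \<Longrightarrow> \<exists>a. homog a g" "\<And>g. g \<in> G \<Longrightarrow> phase_map \<gamma> g \<in> Idl_Free H"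
    and p: "p \<in> Idl_Free G"
  shows "phase_map \<gamma> p \<in> Idl_Free H"
  using p
proof (induction rule: Idl_Free_induct)
  case (gen v w c g)
  obtain a where a: "homog a g" using G(1) gen by blast
  let ?v = "Poly_Mapping.single v c" and ?w = "Poly_Mapping.single w 1"
  have "phase_map \<gamma> (?v * g) = F (weight v) (tmon a) *\<^sub>C (phase_map \<gamma> ?v * phase_map \<gamma> g)"
    by (intro phase_map_mult_homogeneous[where \<gamma> = \<gamma> and F = F, OF _ _ \<gamma>])
      (auto simp: weight_wvec intro!: homog_Free_grading homog_single a)
  moreover have "phase_map \<gamma> (?v * g * ?w) =
    F (tmon (wvec (letters v) + a)) (weight w) *\<^sub>C (phase_map \<gamma> (?v * g) * phase_map \<gamma> ?w)"
    by (intro phase_map_mult_homogeneous[where \<gamma> = \<gamma> and F = F, OF _ _ \<gamma>])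
      (auto simp: weight_wvec intro!: homog_Free_grading homog_mult homog_single a)
  ultimately show ?case
    using G(2)[OF gen] by (simp add: Free_ideal_closed[OF ideal_Idl_Free])
qed (simp_all add: phase_map_zero phase_map_add Free_ideal_closed[OF ideal_Idl_Free])

text \<open>The reciprocal phases trivialise the reciprocal of \<open>F\<close>, so the criterion on
  generators applies in both directions; compatibility of the phases with the involution takes care
  of adjoint generators.\<close>

lemma phase_map_star_ideal_iff:
  assumes \<gamma>: "\<And>v w. \<gamma> (v + w) = \<gamma> v * \<gamma> w * F (weight v) (weight w)" and nz: "\<And>w. \<gamma> w \<noteq> 0"
    and \<gamma>_star: "\<And>w. \<gamma> (word_star w) = cnj (\<gamma> w)"
    and S: "\<And>s. s \<in> S \<Longrightarrow> \<exists>a. homog a s" "\<And>s. s \<in> S \<Longrightarrow> phase_map \<gamma> s \<in> star_ideal Free R"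
    and R: "\<And>r. r \<in> R \<Longrightarrow> \<exists>a. homog a r"
      "\<And>r. r \<in> R \<Longrightarrow> phase_map (\<lambda>w. inverse (\<gamma> w)) r \<in> star_ideal Free S"
  shows "p \<in> star_ideal Free S \<longleftrightarrow> phase_map \<gamma> p \<in> star_ideal Free R"
proof -
  let ?\<delta> = "\<lambda>w. inverse (\<gamma> w)"
  have \<delta>: "?\<delta> (v + w) = ?\<delta> v * ?\<delta> w * inverse (F (weight v) (weight w))" for v w
    by (simp add: \<gamma>)
  have \<delta>_star: "?\<delta> (word_star w) = cnj (?\<delta> w)" for w
    by (simp add: \<gamma>_star)
  have S': "\<exists>a. homog a g" if "g \<in> S \<union> free_star ` S" for g
    using that S(1) homog_star by blast
  have R': "\<exists>a. homog a g" if "g \<in> R \<union> free_star ` R" for g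
    using that R(1) homog_star by blast
  have S'': "phase_map \<gamma> g \<in> Idl_Free (R \<union> free_star ` R)" if "g \<in> S \<union> free_star ` S" for g
    using that S(2) star_ideal_star[of _ R] phase_map_star[where \<gamma> = \<gamma>, OF \<gamma>_star]
    by (auto simp: star_ideal_def)
  have R'': "phase_map ?\<delta> g \<in> Idl_Free (S \<union> free_star ` S)" if "g \<in> R \<union> free_star ` R" for g
    using that R(2) star_ideal_star[of _ S] phase_map_star[where \<gamma> = ?\<delta>, OF \<delta>_star]
    by (auto simp: star_ideal_def)
  have "phase_map \<gamma> p \<in> star_ideal Free R" if "p \<in> star_ideal Free S"
    using phase_map_Idl_Free[where \<gamma> = \<gamma> and F = F and G = "S \<union> free_star ` S", OF \<gamma> S' S''] that by (simp add: star_ideal_def)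
  moreover have "phase_map ?\<delta> q \<in> star_ideal Free S" if "q \<in> star_ideal Free R" for q
    using phase_map_Idl_Free[where \<gamma> = ?\<delta> and F = "\<lambda>\<alpha> \<beta>. inverse (F \<alpha> \<beta>)" and G = "R \<union> free_star ` R",
        OF \<delta> R' R''] that
    by (simp add: star_ideal_def)
  moreover have "phase_map ?\<delta> (phase_map \<gamma> p) = p"
    using phase_map_inverse[of ?\<delta> p] nz by simp
  ultimately show ?thesis by metis
qed

section \<open>The exponent of the cocycle and the phase of a word\<close>

definition form :: "real ^ 4 ^ 4 \<Rightarrow> int ^ 4 \<Rightarrow> int ^ 4 \<Rightarrow> real"
  where "form \<Theta> a b = (\<Sum>\<mu>\<in>UNIV. \<Sum>\<nu>\<in>UNIV. of_int (a $ \<mu>) * \<Theta> $ \<mu> $ \<nu> * of_int (b $ \<nu>))"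

lemma form_simps [simp]:
  "form \<Theta> 0 b = 0" "form \<Theta> a 0 = 0" "form \<Theta> (- a) b = - form \<Theta> a b"
  "form \<Theta> a (- b) = - form \<Theta> a b"
  by (simp_all add: form_def sum_negf)

lemma form_add:
  "form \<Theta> (a + a') b = form \<Theta> a b + form \<Theta> a' b" "form \<Theta> a (b + b') = form \<Theta> a b + form \<Theta> a b'"
  by (simp_all add: form_def sum.distrib distrib_left distrib_right)

lemma form_diff:
  "form \<Theta> (a - a') b = form \<Theta> a b - form \<Theta> a' b" "form \<Theta> a (b - b') = form \<Theta> a b - form \<Theta> a b'"
  using form_add(1)[of \<Theta> a "- a'" b] form_add(2)[of \<Theta> a b "- b'"] by simp_all

lemma form_axis [simp]: "form \<Theta> (axis \<mu> 1) (axis \<nu> 1) = \<Theta> $ \<mu> $ \<nu>"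
proof -
  have "real_of_int (axis \<rho> 1 $ \<sigma>) = (if \<sigma> = \<rho> then 1 else 0)" for \<rho> \<sigma> :: 4
    by (simp add: axis_def)
  then show ?thesis
    by (simp add: form_def mult_delta_left mult_delta_right)
qed

text \<open>The phase of the twisted product of the generators \<open>exp (-\<i> \<Theta>\<^sub>\<mu>\<^sub>\<nu>) Q\<^sup>\<mu>\<^sub>\<nu>\<close>,
  taken over the letters of a word, relative to the untwisted product of the letters.\<close>

fun word_angle :: "real ^ 4 ^ 4 \<Rightarrow> (4 \<times> 4) list \<Rightarrow> real" where
  "word_angle \<Theta> [] = 0"
| "word_angle \<Theta> ((\<mu>, \<nu>) # l) =
    - \<Theta> $ \<mu> $ \<nu> + form \<Theta> (axis \<mu> 1 - axis \<nu> 1) (wvec l) + word_angle \<Theta> l"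

definition word_phase :: "real ^ 4 ^ 4 \<Rightarrow> (4 \<times> 4) word \<Rightarrow> complex"
  where "word_phase \<Theta> w = cis (word_angle \<Theta> (letters w))"

text \<open>The coboundary identity in additive form: by bilinearity, splitting a word anywhere
  leaves exactly the pairing of the two weights.\<close>

lemma word_angle_append:
  "word_angle \<Theta> (l @ m) = word_angle \<Theta> l + word_angle \<Theta> m + form \<Theta> (wvec l) (wvec m)"
  by (induction l) (auto simp: form_add)

lemma word_phase_simps [simp]: "word_phase \<Theta> 0 = 1" "word_phase \<Theta> w \<noteq> 0"
  by (simp_all add: word_phase_def)

text \<open>This is \<open>form\<close> on the weights of two generators.\<close>

definition gen_form :: "real ^ 4 ^ 4 \<Rightarrow> 4 \<Rightarrow> 4 \<Rightarrow> 4 \<Rightarrow> 4 \<Rightarrow> real"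
  where "gen_form \<Theta> \<mu> \<nu> \<rho> \<sigma> = \<Theta> $ \<mu> $ \<rho> - \<Theta> $ \<mu> $ \<sigma> - \<Theta> $ \<nu> $ \<rho> + \<Theta> $ \<nu> $ \<sigma>"

lemma gen_mult: "gen \<mu> \<nu> * gen \<rho> \<sigma> = Poly_Mapping.single (Word [(\<mu>, \<nu>), (\<rho>, \<sigma>)]) 1"
  by (simp add: gen_def mult_single plus_word_def)

lemma phase_map_gen: "phase_map (word_phase \<Theta>) (gen \<mu> \<nu>) = cis (- \<Theta> $ \<mu> $ \<nu>) *\<^sub>C gen \<mu> \<nu>"
  by (simp add: gen_def phase_map_single scal_single word_phase_def)

lemma phase_map_gen_mult:
  "phase_map (word_phase \<Theta>) (gen \<mu> \<nu> * gen \<rho> \<sigma>) =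
    cis (- \<Theta> $ \<mu> $ \<nu> - \<Theta> $ \<rho> $ \<sigma> + gen_form \<Theta> \<mu> \<nu> \<rho> \<sigma>) *\<^sub>C (gen \<mu> \<nu> * gen \<rho> \<sigma>)"
  by (simp add: gen_mult phase_map_single scal_single word_phase_def form_diff gen_form_def algebra_simps)

lemma phase_map_one: "phase_map (word_phase \<Theta>) 1 = 1"
  using phase_map_single[of "word_phase \<Theta>" 0 1] by simp

context
  fixes \<Theta> :: "real ^ 4 ^ 4"
  assumes antisym: "\<And>\<mu> \<nu>. \<Theta> $ \<nu> $ \<mu> = - \<Theta> $ \<mu> $ \<nu>"
begin

lemma form_antisym: "form \<Theta> b a = - form \<Theta> a b"
proof -
  have "form \<Theta> b a =
    (\<Sum>\<mu>\<in>UNIV. \<Sum>\<nu>\<in>UNIV. - (of_int (a $ \<nu>) * \<Theta> $ \<nu> $ \<mu> * of_int (b $ \<mu>)))"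
    unfolding form_def by (intro sum.cong refl, subst antisym) simp
  also have "\<dots> = - form \<Theta> a b"
    unfolding form_def sum_negf by (subst sum.swap) simp
  finally show ?thesis .
qed

text \<open>The adjoint word transposes the letters, which changes the sign of both weights in each
  pairing, and reverses their order, which changes the sign of the pairing by antisymmetry.\<close>

lemma word_angle_star: "word_angle \<Theta> (rev (map prod.swap l)) = - word_angle \<Theta> l"
proof (induction l)
  case (Cons x l)
  obtain \<mu> \<nu> where x: "x = (\<mu>, \<nu>)" by force
  show ?case
    using Cons antisym[of \<mu> \<nu>] form_antisym[of "wvec l" "axis \<mu> 1"] form_antisym[of "wvec l" "axis \<nu> 1"]
    by (simp add: x word_angle_append form_diff)
qed simp

lemma word_phase_star: "word_phase \<Theta> (word_star w) = cnj (word_phase \<Theta> w)"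
  by (simp add: word_phase_def word_star_def word_angle_star cis_cnj)

lemma diag_0 [simp]: "\<Theta> $ \<mu> $ \<mu> = 0"
  using antisym[of \<mu> \<mu>] by simp

lemma gen_form_swap:
  "gen_form \<Theta> \<rho> \<sigma> \<mu> \<nu> = - gen_form \<Theta> \<mu> \<nu> \<rho> \<sigma>"
  "gen_form \<Theta> \<nu> \<mu> \<rho> \<sigma> = - gen_form \<Theta> \<mu> \<nu> \<rho> \<sigma>"
  "gen_form \<Theta> \<mu> \<nu> \<sigma> \<rho> = - gen_form \<Theta> \<mu> \<nu> \<rho> \<sigma>"
  using antisym[of \<rho> \<mu>] antisym[of \<rho> \<nu>] antisym[of \<sigma> \<mu>] antisym[of \<sigma> \<nu>]
  by (simp_all add: gen_form_def)

lemma word_phase_plus: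
  assumes "\<And>\<mu>. (\<Sum>\<nu>\<in>UNIV. \<Theta> $ \<mu> $ \<nu>) = 0" "\<And>\<nu>. (\<Sum>\<mu>\<in>UNIV. \<Theta> $ \<mu> $ \<nu>) = 0"
  shows "word_phase \<Theta> (v + w) = word_phase \<Theta> v * word_phase \<Theta> w * cocycle \<Theta> (weight v) (weight w)"
  unfolding weight_wvec cocycle_tmon[OF assms] form_def[symmetric]
  by (simp add: word_phase_def word_angle_append cis_mult cis_conv_exp[symmetric])

end

section \<open>The classical relations\<close>

abbreviation comm_gen :: "4 \<Rightarrow> 4 \<Rightarrow> 4 \<Rightarrow> 4 \<Rightarrow> free"
  where "comm_gen \<mu> \<nu> \<rho> \<sigma> \<equiv> gen \<mu> \<nu> * gen \<rho> \<sigma> - gen \<rho> \<sigma> * gen \<mu> \<nu>"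

abbreviation trace_rel :: free
  where "trace_rel \<equiv> (\<Sum>\<mu>\<in>UNIV. gen \<mu> \<mu>) - 1"

abbreviation idem_rel :: "4 \<Rightarrow> 4 \<Rightarrow> free"
  where "idem_rel \<mu> \<nu> \<equiv> (\<Sum>\<rho>\<in>UNIV. gen \<mu> \<rho> * gen \<rho> \<nu>) - gen \<mu> \<nu>"

abbreviation minor_rel :: "4 \<Rightarrow> 4 \<Rightarrow> 4 \<Rightarrow> free"
  where "minor_rel \<mu> \<rho> \<nu> \<equiv> gen \<rho> \<rho> * gen \<mu> \<nu> - gen \<mu> \<rho> * gen \<rho> \<nu>"

lemma CP3_rels_iff:
  "r \<in> CP3_rels \<longleftrightarrow> (\<exists>\<mu> \<nu> \<rho> \<sigma>. r = comm_gen \<mu> \<nu> \<rho> \<sigma>) \<or> (\<exists>\<mu> \<nu>. r = idem_rel \<mu> \<nu>) \<or> r = trace_rel"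
  by (auto simp: CP3_rels_def)

lemma star_ideal_gen: "s \<in> S \<Longrightarrow> s \<in> star_ideal Free S"
  by (simp add: star_ideal_def Idl_Free_gen)

lemma star_ideal_mono: "S \<subseteq> R \<Longrightarrow> star_ideal Free S \<subseteq> star_ideal Free R"
  unfolding star_ideal_def by (rule Idl_Free_mono) (auto intro: Idl_Free_gen)

lemma free_induct [case_names scalar gen add mult]:
  assumes scalar: "\<And>c. P (Poly_Mapping.single 0 c)" and gen: "\<And>\<mu> \<nu>. P (gen \<mu> \<nu>)"
    and add: "\<And>p q. P p \<Longrightarrow> P q \<Longrightarrow> P (p + q)" and mult: "\<And>p q. P p \<Longrightarrow> P q \<Longrightarrow> P (p * q)"
  shows "P p"
proof -
  have word: "P (Poly_Mapping.single (Word l) c)" for l c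
  proof (induction l)
    case Nil
    then show ?case using scalar[of c] by (simp add: zero_word_def)
  next
    case (Cons x l)
    obtain \<mu> \<nu> where x: "x = (\<mu>, \<nu>)" by force
    have "Poly_Mapping.single (Word (x # l)) c = gen \<mu> \<nu> * Poly_Mapping.single (Word l) c"
      by (simp add: x gen_def mult_single plus_word_def)
    then show ?case using mult[OF gen Cons] by simp
  qed
  have "P (\<Sum>w\<in>A. Poly_Mapping.single w (f w))" for A and f :: "_ \<Rightarrow> complex"
    using scalar[of 0] word[of "letters _"]
    by (induction A rule: infinite_finite_induct) (auto intro: add)
  then show ?thesis
    by (subst poly_mapping_sum_single[of p])
qed

abbreviation K_CP3 :: "free set"
  where "K_CP3 \<equiv> star_ideal Free CP3_rels"

text \<open>The elements commuting with a given one modulo the ideal are closed under sums and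
  products. This is applied first to the right factor against a single generator, then to the left
  factor.\<close>

lemma K_CP3_commute: "p * q - q * p \<in> K_CP3"
proof -
  note closed = Free_ideal_closed[OF ideal_star_ideal] Free_ideal_sym[OF ideal_star_ideal]
  have add: "a * (b + c) - (b + c) * a \<in> K_CP3"
    if "a * b - b * a \<in> K_CP3" "a * c - c * a \<in> K_CP3" for a b c
    using closed(2)[OF that] by (simp add: algebra_simps)
  have mult: "a * (b * c) - b * c * a \<in> K_CP3"
    if "a * b - b * a \<in> K_CP3" "a * c - c * a \<in> K_CP3" for a b c
    using closed(2)[OF closed(4)[OF that(1), of c] closed(3)[OF that(2), of b]]
    by (simp add: algebra_simps)
  have scalar: "a * Poly_Mapping.single 0 c - Poly_Mapping.single 0 c * a \<in> K_CP3" for a c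
    using closed(1) by (simp add: single_0_commute scal_def)
  have gen: "gen \<mu> \<nu> * q - q * gen \<mu> \<nu> \<in> K_CP3" for \<mu> \<nu> q
  proof (induction q rule: free_induct)
    case (gen \<rho> \<sigma>)
    have "comm_gen \<mu> \<nu> \<rho> \<sigma> \<in> CP3_rels" unfolding CP3_rels_iff by blast
    then show ?case by (rule star_ideal_gen)
  qed (simp_all add: scalar add mult)
  have "q * p - p * q \<in> K_CP3"
    by (induction p rule: free_induct) (simp_all add: scalar add mult closed(6)[OF gen])
  then show ?thesis by (rule closed(6))
qed

text \<open>The quotient as a type, so that the type class lemma on minors applies to it. The class
  \<open>comm_ring_1\<close> would require the quotient to be nontrivial; this is why that lemma is
  stated for rings without unit.\<close>

quotient_type cp3 = free / "\<lambda>p q. p - q \<in> K_CP3"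
proof (rule equivpI)
  show "reflp (\<lambda>p q. p - q \<in> K_CP3)"
    by (simp add: reflp_def Free_ideal_closed(1)[OF ideal_star_ideal])
  show "symp (\<lambda>p q. p - q \<in> K_CP3)"
    by (intro sympI) (rule Free_ideal_sym[OF ideal_star_ideal])
  show "transp (\<lambda>p q. p - q \<in> K_CP3)"
    by (intro transpI) (rule Free_ideal_trans[OF ideal_star_ideal])
qed

instantiation cp3 :: comm_ring
begin

lift_definition zero_cp3 :: cp3 is 0 .

lift_definition plus_cp3 :: "cp3 \<Rightarrow> cp3 \<Rightarrow> cp3" is "(+)"
  by (rule Free_ideal_add_cong[OF ideal_star_ideal])

lift_definition uminus_cp3 :: "cp3 \<Rightarrow> cp3" is uminus
  using Free_ideal_sym[OF ideal_star_ideal] by simp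

lift_definition minus_cp3 :: "cp3 \<Rightarrow> cp3 \<Rightarrow> cp3" is "(-)"
  using Free_ideal_diff[OF ideal_star_ideal] by (fastforce simp: algebra_simps)

lift_definition times_cp3 :: "cp3 \<Rightarrow> cp3 \<Rightarrow> cp3" is "(*)"
  by (rule Free_ideal_mult_cong[OF ideal_star_ideal])

instance
  by standard (transfer; simp add: algebra_simps Free_ideal_closed(1)[OF ideal_star_ideal] K_CP3_commute)+

end

lemma abs_cp3_simps:
  "abs_cp3 p + abs_cp3 q = abs_cp3 (p + q)" "abs_cp3 p * abs_cp3 q = abs_cp3 (p * q)"
  "abs_cp3 0 = 0"
  by (simp_all add: plus_cp3.abs_eq times_cp3.abs_eq zero_cp3_def)

lemma abs_cp3_sum: "(\<Sum>x\<in>A. abs_cp3 (f x)) = abs_cp3 (sum f A)"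
  by (induction A rule: infinite_finite_induct) (simp_all add: abs_cp3_simps)

lemma abs_cp3_eq_0: "abs_cp3 p = 0 \<longleftrightarrow> p \<in> K_CP3"
  by (simp add: zero_cp3_def cp3.abs_eq_iff)

lemma K_CP3_minor: "gen i a * gen j b - gen i b * gen j a \<in> K_CP3"
proof -
  note closed = Free_ideal_closed[OF ideal_star_ideal]
  have "abs_cp3 (gen i a) * abs_cp3 (gen j b) = abs_cp3 (gen i b) * abs_cp3 (gen j a)"
  proof (rule trace_one_idempotent_minor)
    have "idem_rel \<mu> \<nu> \<in> CP3_rels" for \<mu> \<nu>
      unfolding CP3_rels_iff by blast
    then show "(\<Sum>\<rho>\<in>UNIV. abs_cp3 (gen \<mu> \<rho>) * abs_cp3 (gen \<rho> \<nu>)) = abs_cp3 (gen \<mu> \<nu>)" for \<mu> \<nu>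
      unfolding abs_cp3_simps abs_cp3_sum cp3.abs_eq_iff by (intro star_ideal_gen)
    have "trace_rel \<in> K_CP3"
      by (rule star_ideal_gen) (simp add: CP3_rels_iff)
    then show "(\<Sum>\<mu>\<in>UNIV. abs_cp3 (gen \<mu> \<mu>)) * x = x" for x
    proof (induction x)
      case (1 p)
      then have "trace_rel * p \<in> K_CP3" by (rule closed(4))
      then show ?case
        unfolding abs_cp3_simps abs_cp3_sum cp3.abs_eq_iff by (simp add: left_diff_distrib)
    qed
    show "x = 0" if "x + x = 0" for x :: cp3
      using that
    proof (induction x)
      case (1 p)
      \<comment> \<open>Torsion is excluded by dividing with a complex scalar.\<close>
      then have "(1 / 2) *\<^sub>C (p + p) \<in> K_CP3"
        unfolding abs_cp3_simps abs_cp3_eq_0 by (rule closed(5))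
      moreover have "(1 / 2) *\<^sub>C (p + p) = p"
        by (rule poly_mapping_eqI) (simp add: lookup_scal lookup_add)
      ultimately show ?case by (simp add: abs_cp3_eq_0)
    qed
    show "x = 0" if "x + x + x = 0" for x :: cp3
      using that
    proof (induction x)
      case (1 p)
      then have "(1 / 3) *\<^sub>C (p + p + p) \<in> K_CP3"
        unfolding abs_cp3_simps abs_cp3_eq_0 by (rule closed(5))
      moreover have "(1 / 3) *\<^sub>C (p + p + p) = p"
        by (rule poly_mapping_eqI) (simp add: lookup_scal lookup_add)
      ultimately show ?case by (simp add: abs_cp3_eq_0)
    qed
  qed
  then show ?thesis
    by (simp add: abs_cp3_simps cp3.abs_eq_iff)
qed

lemma K_CP3_minor_rel: "minor_rel \<mu> \<rho> \<nu> \<in> K_CP3"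
  using Free_ideal_closed(2)[OF ideal_star_ideal K_CP3_minor[of \<rho> \<rho> \<mu> \<nu>]
      K_CP3_commute[of "gen \<rho> \<nu>" "gen \<mu> \<rho>"]]
  by simp

definition trace_diag_rels :: "free set"
  where "trace_diag_rels =
    {trace_rel,
     gen 1 1 - gen 1 1 * gen 1 1 - (gen 2 1 * gen 1 2 + gen 3 1 * gen 1 3 + gen 4 1 * gen 1 4),
     gen 2 1 * gen 1 2 - gen 4 3 * gen 3 4 - (gen 1 1 * gen 2 2 - gen 3 3 * gen 4 4),
     gen 3 1 * gen 1 3 - gen 4 2 * gen 2 4 - (gen 1 1 * gen 3 3 - gen 2 2 * gen 4 4),
     gen 4 1 * gen 1 4 - gen 3 2 * gen 2 3 - (gen 1 1 * gen 4 4 - gen 2 2 * gen 3 3)}"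

text \<open>Apart from the trace and the weight-zero relations, the list has one minor for each
  unordered pair of distinct \<open>\<mu>\<close>, \<open>\<nu>\<close> and each of the two
  remaining \<open>\<rho>\<close>: twelve in all.\<close>

lemma projection_rels_eq:
  "projection_rels = trace_diag_rels \<union>
    {minor_rel 3 1 4, minor_rel 2 1 4, minor_rel 2 1 3, minor_rel 3 2 4, minor_rel 2 3 4,
     minor_rel 2 4 3, minor_rel 1 3 2, minor_rel 1 2 3, minor_rel 1 2 4, minor_rel 1 4 2,
     minor_rel 1 4 3, minor_rel 1 3 4}"
  by (simp add: projection_rels_def trace_diag_rels_def Let_def free_star_gen sum_4 right_diff_distrib
      Un_insert_right insert_commute)

lemma minus_rels_eq:
  "minus_rels = {gen 2 1 * gen 1 2 - gen 1 1 * gen 2 2, gen 3 1 * gen 1 3 - gen 1 1 * gen 3 3,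
    gen 4 1 * gen 1 4 - gen 1 1 * gen 4 4}"
  by (simp add: minus_rels_def Let_def free_star_gen)

lemma K_CP3_projection_rels: "projection_rels \<subseteq> K_CP3"
proof -
  note closed = Free_ideal_closed[OF ideal_star_ideal[of CP3_rels]]
  note diff = Free_ideal_diff[OF ideal_star_ideal[of CP3_rels]]
  have rels: "trace_rel \<in> K_CP3" "idem_rel 1 1 \<in> K_CP3"
    by (rule star_ideal_gen; unfold CP3_rels_iff; blast)+
  have "comm_gen 1 2 2 1 + comm_gen 1 3 3 1 + comm_gen 1 4 4 1 - idem_rel 1 1 \<in> K_CP3"
    by (rule diff[OF closed(2)[OF closed(2)]], (rule K_CP3_commute)+, rule rels)
  \<comment> \<open>Each of \<open>X - U = ab - cd\<close> and its two analogues is the difference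
    of two vanishing minors, for instance those of \<open>U = cd\<close> and
    \<open>X = ab\<close>.\<close>
  moreover have "minor_rel 4 3 4 - minor_rel 2 1 2 \<in> K_CP3" "minor_rel 4 2 4 - minor_rel 3 1 3 \<in> K_CP3"
    "minor_rel 3 2 3 - minor_rel 4 1 4 \<in> K_CP3"
    by (rule diff; rule K_CP3_minor_rel)+
  moreover have "gen 1 1 - gen 1 1 * gen 1 1 - (gen 2 1 * gen 1 2 + gen 3 1 * gen 1 3 + gen 4 1 * gen 1 4) =
      comm_gen 1 2 2 1 + comm_gen 1 3 3 1 + comm_gen 1 4 4 1 - idem_rel 1 1"
    by (simp add: sum_4)
  moreover have
    "gen 2 1 * gen 1 2 - gen 4 3 * gen 3 4 - (gen 1 1 * gen 2 2 - gen 3 3 * gen 4 4) =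
      minor_rel 4 3 4 - minor_rel 2 1 2"
    "gen 3 1 * gen 1 3 - gen 4 2 * gen 2 4 - (gen 1 1 * gen 3 3 - gen 2 2 * gen 4 4) =
      minor_rel 4 2 4 - minor_rel 3 1 3"
    "gen 4 1 * gen 1 4 - gen 3 2 * gen 2 3 - (gen 1 1 * gen 4 4 - gen 2 2 * gen 3 3) =
      minor_rel 3 2 3 - minor_rel 4 1 4"
    by simp_all
  ultimately have "trace_diag_rels \<subseteq> K_CP3"
    unfolding trace_diag_rels_def
    using rels(1) by (simp only: insert_subset empty_subsetI simp_thms)
  then show ?thesis
    unfolding projection_rels_eq using K_CP3_minor_rel by blast
qed

section \<open>The twisted relations\<close>

lemma cis_scal: "cis a *\<^sub>C cis b *\<^sub>C p = cis (a + b) *\<^sub>C p"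
  by (simp add: scal_simps cis_mult)

text \<open>Eigenvectors of the scaling with the weight and the phase of a single generator. Such a
  relation keeps its line under the scaling and its inverse, hence lies in an ideal together with
  its rescalings. The pair 1, 1 stands for weight zero and phase one.\<close>

definition eigen :: "real ^ 4 ^ 4 \<Rightarrow> 4 \<Rightarrow> 4 \<Rightarrow> free \<Rightarrow> bool"
  where "eigen \<Theta> \<mu> \<nu> p \<longleftrightarrow> homog (axis \<mu> 1 - axis \<nu> 1) p \<and>
    phase_map (word_phase \<Theta>) p = cis (- \<Theta> $ \<mu> $ \<nu>) *\<^sub>C p"

lemma eigen_add: "eigen \<Theta> \<mu> \<nu> p \<Longrightarrow> eigen \<Theta> \<mu> \<nu> q \<Longrightarrow> eigen \<Theta> \<mu> \<nu> (p + q)"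
  by (simp add: eigen_def homog_add phase_map_add scal_simps)

lemma eigen_diff: "eigen \<Theta> \<mu> \<nu> p \<Longrightarrow> eigen \<Theta> \<mu> \<nu> q \<Longrightarrow> eigen \<Theta> \<mu> \<nu> (p - q)"
  by (simp add: eigen_def homog_diff phase_map_diff scal_simps)

lemma eigen_phase_map:
  assumes "eigen \<Theta> \<mu> \<nu> r" and I: "ideal I Free" "r \<in> I"
  shows "\<exists>a. homog a r" "phase_map (word_phase \<Theta>) r \<in> I"
    "phase_map (\<lambda>w. inverse (word_phase \<Theta> w)) r \<in> I"
proof -
  show "\<exists>a. homog a r" "phase_map (word_phase \<Theta>) r \<in> I"
    using assms Free_ideal_closed(5)[OF I] by (auto simp: eigen_def)
  have "r = cis (\<Theta> $ \<mu> $ \<nu>) *\<^sub>C phase_map (word_phase \<Theta>) r"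
    using assms(1) by (simp add: eigen_def scal_simps cis_mult)
  then have "phase_map (word_phase \<Theta>) (cis (\<Theta> $ \<mu> $ \<nu>) *\<^sub>C r) = r"
    by (simp add: phase_map_scal)
  then have "phase_map (\<lambda>w. inverse (word_phase \<Theta> w)) r = cis (\<Theta> $ \<mu> $ \<nu>) *\<^sub>C r"
    using phase_map_inverse[of "\<lambda>w. inverse (word_phase \<Theta> w)" "cis (\<Theta> $ \<mu> $ \<nu>) *\<^sub>C r"] by simp
  then show "phase_map (\<lambda>w. inverse (word_phase \<Theta> w)) r \<in> I"
    using Free_ideal_closed(5)[OF I] by simp
qed

text \<open>Interchanging two factors in the twisted product costs \<open>F(a,b) / F(b,a)\<close>;
  antisymmetry of the exponent doubles it, which explains the 2.\<close>

definition twisted_comm :: "real ^ 4 ^ 4 \<Rightarrow> 4 \<Rightarrow> 4 \<Rightarrow> 4 \<Rightarrow> 4 \<Rightarrow> free"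
  where "twisted_comm \<Theta> \<mu> \<nu> \<rho> \<sigma> =
    gen \<mu> \<nu> * gen \<rho> \<sigma> - cis (2 * gen_form \<Theta> \<mu> \<nu> \<rho> \<sigma>) *\<^sub>C (gen \<rho> \<sigma> * gen \<mu> \<nu>)"

lemma homog_gen_mult:
  "\<exists>a. homog a (gen \<mu> \<nu> * gen \<rho> \<sigma>) \<and> homog a (gen \<rho> \<sigma> * gen \<mu> \<nu>)"
  using homog_mult[OF homog_gen homog_gen, of \<mu> \<nu> \<rho> \<sigma>] homog_mult[OF homog_gen homog_gen, of \<rho> \<sigma> \<mu> \<nu>]
  by (metis add.commute)

lemma homog_comm:
  "\<exists>a. homog a (comm_gen \<mu> \<nu> \<rho> \<sigma>)" "\<exists>a. homog a (twisted_comm \<Theta> \<mu> \<nu> \<rho> \<sigma>)"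
  using homog_gen_mult[of \<mu> \<nu> \<rho> \<sigma>] homog_diff homog_scal unfolding twisted_comm_def by blast+

context
  fixes \<Theta> :: "real ^ 4 ^ 4"
  assumes antisym: "\<And>\<mu> \<nu>. \<Theta> $ \<nu> $ \<mu> = - \<Theta> $ \<mu> $ \<nu>"
begin

lemma eigen_gen: "eigen \<Theta> \<mu> \<nu> (gen \<mu> \<nu>)" "eigen \<Theta> 1 1 (gen \<mu> \<mu>)"
  using homog_gen[of \<mu> \<mu>] by (simp_all add: eigen_def homog_gen phase_map_gen diag_0[OF antisym])

lemma eigen_one: "eigen \<Theta> 1 1 1"
  by (simp add: eigen_def homog_one phase_map_one diag_0[OF antisym] scal_simps)

text \<open>For a path from \<open>\<mu>\<close> through \<open>\<rho>\<close> to
  \<open>\<nu>\<close> the pairing contributes \<open>\<Theta>(\<mu>,\<rho>) - \<Theta>(\<mu>,\<nu>)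
  + \<Theta>(\<rho>,\<nu>)\<close>; the normalisation of the two letters cancels the outer terms and
  leaves \<open>- \<Theta>(\<mu>,\<nu>)\<close>. A diagonal letter has weight zero and pairs
  trivially.\<close>

lemma eigen_mult:
  "eigen \<Theta> \<mu> \<nu> (gen \<mu> \<rho> * gen \<rho> \<nu>)" "eigen \<Theta> \<mu> \<nu> (gen \<rho> \<rho> * gen \<mu> \<nu>)"
  "eigen \<Theta> 1 1 (gen \<mu> \<nu> * gen \<nu> \<mu>)" "eigen \<Theta> 1 1 (gen \<mu> \<mu> * gen \<nu> \<nu>)"
  using homog_mult[OF homog_gen homog_gen, of \<mu> \<rho> \<rho> \<nu>] homog_mult[OF homog_gen homog_gen, of \<rho> \<rho> \<mu> \<nu>]
    homog_mult[OF homog_gen homog_gen, of \<mu> \<nu> \<nu> \<mu>] homog_mult[OF homog_gen homog_gen, of \<mu> \<mu> \<nu> \<nu>]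
    antisym[of \<mu> \<nu>]
  by (simp_all add: eigen_def phase_map_gen_mult gen_form_def diag_0[OF antisym])

lemma eigen_trace_rel: "eigen \<Theta> 1 1 trace_rel"
  unfolding sum_4 by (intro eigen_diff eigen_add eigen_gen eigen_one)

lemma eigen_idem_rel: "eigen \<Theta> \<mu> \<nu> (idem_rel \<mu> \<nu>)"
  unfolding sum_4 by (intro eigen_diff eigen_add eigen_gen eigen_mult)

lemma eigen_projection_rels: "r \<in> projection_rels \<Longrightarrow> \<exists>\<mu> \<nu>. eigen \<Theta> \<mu> \<nu> r"
proof -
  have "eigen \<Theta> 1 1 r" if "r \<in> trace_diag_rels" for r
    using that unfolding trace_diag_rels_def
    by (elim insertE emptyE; hypsubst)
      (intro eigen_diff eigen_add eigen_gen eigen_mult(3,4) eigen_trace_rel)+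
  moreover have "eigen \<Theta> \<mu> \<nu> (minor_rel \<mu> \<rho> \<nu>)" for \<mu> \<rho> \<nu>
    by (intro eigen_diff eigen_mult)
  ultimately show "r \<in> projection_rels \<Longrightarrow> \<exists>\<mu> \<nu>. eigen \<Theta> \<mu> \<nu> r"
    unfolding projection_rels_eq by blast
qed

lemma eigen_minus_rels: "r \<in> minus_rels \<Longrightarrow> eigen \<Theta> 1 1 r"
  unfolding minus_rels_eq
  by (elim insertE emptyE; hypsubst) (intro eigen_diff eigen_mult(3,4))+

lemma phase_map_twisted_comm:
  "phase_map (word_phase \<Theta>) (twisted_comm \<Theta> \<mu> \<nu> \<rho> \<sigma>) =
    cis (- \<Theta> $ \<mu> $ \<nu> - \<Theta> $ \<rho> $ \<sigma> + gen_form \<Theta> \<mu> \<nu> \<rho> \<sigma>) *\<^sub>C comm_gen \<mu> \<nu> \<rho> \<sigma>"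
proof -
  have "2 * gen_form \<Theta> \<mu> \<nu> \<rho> \<sigma> + (- \<Theta> $ \<rho> $ \<sigma> - \<Theta> $ \<mu> $ \<nu> + gen_form \<Theta> \<rho> \<sigma> \<mu> \<nu>) =
    - \<Theta> $ \<mu> $ \<nu> - \<Theta> $ \<rho> $ \<sigma> + gen_form \<Theta> \<mu> \<nu> \<rho> \<sigma>"
    using gen_form_swap(1)[OF antisym, of \<rho> \<sigma> \<mu> \<nu>] by simp
  then show ?thesis
    by (simp only: twisted_comm_def phase_map_diff phase_map_scal phase_map_gen_mult cis_scal scal_simps(2))
qed

lemma phase_map_comm_gen:
  "phase_map (\<lambda>w. inverse (word_phase \<Theta> w)) (comm_gen \<mu> \<nu> \<rho> \<sigma>) =
    cis (\<Theta> $ \<mu> $ \<nu> + \<Theta> $ \<rho> $ \<sigma> - gen_form \<Theta> \<mu> \<nu> \<rho> \<sigma>) *\<^sub>C twisted_comm \<Theta> \<mu> \<nu> \<rho> \<sigma>"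
proof -
  let ?c = "\<Theta> $ \<mu> $ \<nu> + \<Theta> $ \<rho> $ \<sigma> - gen_form \<Theta> \<mu> \<nu> \<rho> \<sigma>"
  have "phase_map (word_phase \<Theta>) (cis ?c *\<^sub>C twisted_comm \<Theta> \<mu> \<nu> \<rho> \<sigma>) = comm_gen \<mu> \<nu> \<rho> \<sigma>"
    by (simp only: phase_map_scal phase_map_twisted_comm cis_scal) (simp add: scal_simps)
  then show ?thesis
    using phase_map_inverse[of "\<lambda>w. inverse (word_phase \<Theta> w)" "cis ?c *\<^sub>C twisted_comm \<Theta> \<mu> \<nu> \<rho> \<sigma>"] by simp
qed

text \<open>Taking an adjoint transposes the index pair of a generator and so negates its weight;
  this is the rule of inverse factors.\<close>

lemma comm_rels_twisted_comm:
  "comm_rels (cis (2 * gen_form \<Theta> \<mu> \<nu> \<rho> \<sigma>)) (gen \<mu> \<nu>) (gen \<rho> \<sigma>) =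
    {twisted_comm \<Theta> \<mu> \<nu> \<rho> \<sigma>, twisted_comm \<Theta> \<mu> \<nu> \<sigma> \<rho>, twisted_comm \<Theta> \<nu> \<mu> \<rho> \<sigma>, twisted_comm \<Theta> \<nu> \<mu> \<sigma> \<rho>}"
  by (simp add: comm_rels_def twisted_comm_def free_star_gen gen_form_swap(2)[OF antisym, of \<nu> \<mu>]
      gen_form_swap(3)[OF antisym, of _ _ \<sigma> \<rho>])

lemma twisted_comm_swap:
  "twisted_comm \<Theta> \<rho> \<sigma> \<mu> \<nu> = - (cis (- 2 * gen_form \<Theta> \<mu> \<nu> \<rho> \<sigma>) *\<^sub>C twisted_comm \<Theta> \<mu> \<nu> \<rho> \<sigma>)"
  by (simp add: twisted_comm_def scal_simps cis_mult gen_form_swap(1)[OF antisym, of \<mu> \<nu> \<rho> \<sigma>])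

lemma twisted_comm_same:
  "twisted_comm \<Theta> \<mu> \<mu> \<rho> \<sigma> = comm_gen \<mu> \<mu> \<rho> \<sigma>" "twisted_comm \<Theta> \<mu> \<nu> \<nu> \<mu> = comm_gen \<mu> \<nu> \<nu> \<mu>"
  "twisted_comm \<Theta> \<mu> \<nu> \<mu> \<nu> = 0"
  using antisym[of \<mu> \<nu>] by (simp_all add: twisted_comm_def gen_form_def diag_0[OF antisym] scal_simps)

context
  assumes rows: "\<And>\<mu>. (\<Sum>\<nu>\<in>UNIV. \<Theta> $ \<mu> $ \<nu>) = 0"
    and theta_A: "theta_A \<Theta> = - (1 / 2) * theta \<Theta>"
    and theta_B: "theta_B \<Theta> = - (1 / 2) * theta \<Theta>"
begin

text \<open>An antisymmetric matrix with vanishing row sums has three free parameters. The two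
  conditions on \<open>theta_A\<close> and \<open>theta_B\<close> leave only \<open>theta\<close>,
  and the linear system can be solved.\<close>

lemma Theta_eq:
  "\<Theta> $ 1 $ 2 = 0" "\<Theta> $ 1 $ 3 = theta \<Theta> / 4" "\<Theta> $ 1 $ 4 = - theta \<Theta> / 4"
  "\<Theta> $ 2 $ 3 = - theta \<Theta> / 4" "\<Theta> $ 2 $ 4 = theta \<Theta> / 4" "\<Theta> $ 3 $ 4 = 0"
  "\<Theta> $ 2 $ 1 = 0" "\<Theta> $ 3 $ 1 = - theta \<Theta> / 4" "\<Theta> $ 4 $ 1 = theta \<Theta> / 4"
  "\<Theta> $ 3 $ 2 = theta \<Theta> / 4" "\<Theta> $ 4 $ 2 = - theta \<Theta> / 4" "\<Theta> $ 4 $ 3 = 0"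
  using rows[of 1] rows[of 2] rows[of 3] rows[of 4] theta_A theta_B
    antisym[of 1 2] antisym[of 1 3] antisym[of 1 4] antisym[of 2 3] antisym[of 2 4] antisym[of 3 4]
  unfolding sum_4 theta_A_def theta_B_def theta_def diag_0[OF antisym] by - argo+

text \<open>The fifteen quadruples are the unordered pairs of the six entries above the diagonal,
  ordered as in the listed relations. Their factors come from the solved matrix.\<close>

lemma commutation_rels_eq:
  "commutation_rels (theta \<Theta>) =
    {twisted_comm \<Theta> \<mu> \<mu> \<rho> \<sigma> | \<mu> \<rho> \<sigma>. True} \<union> {twisted_comm \<Theta> \<mu> \<nu> \<nu> \<mu> | \<mu> \<nu>. True} \<union>
    (\<Union>(\<mu>, \<nu>, \<rho>, \<sigma>)\<in>{(1, 2, 1, 4), (1, 3, 1, 2), (1, 3, 1, 4), (3, 4, 2, 4), (3, 4, 2, 3), (2, 4, 2, 3),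
        (1, 2, 3, 4), (1, 2, 2, 4), (1, 2, 2, 3), (1, 3, 3, 4), (1, 3, 2, 4), (1, 3, 2, 3),
        (1, 4, 3, 4), (1, 4, 2, 4), (1, 4, 2, 3)}.
      {twisted_comm \<Theta> \<mu> \<nu> \<rho> \<sigma>, twisted_comm \<Theta> \<mu> \<nu> \<sigma> \<rho>, twisted_comm \<Theta> \<nu> \<mu> \<rho> \<sigma>, twisted_comm \<Theta> \<nu> \<mu> \<sigma> \<rho>})"
proof -
  let ?cis = "\<lambda>\<mu> \<nu> \<rho> \<sigma>. cis (2 * gen_form \<Theta> \<mu> \<nu> \<rho> \<sigma>)"
  have e: "exp (\<i> * complex_of_real (theta \<Theta>)) = cis (theta \<Theta>)"
    by (simp add: cis_conv_exp)
  have e2: "cis (theta \<Theta>) ^ 2 = cis (2 * theta \<Theta>)"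
    unfolding power2_eq_square cis_mult by simp
  have c:
    "?cis 1 2 1 4 = cis (theta \<Theta>)" "?cis 1 3 1 2 = cis (theta \<Theta>)" "?cis 1 3 1 4 = cis (theta \<Theta>)"
    "?cis 3 4 2 4 = cis (theta \<Theta>)" "?cis 3 4 2 3 = cis (theta \<Theta>)" "?cis 2 4 2 3 = cis (theta \<Theta>)"
    "?cis 1 2 3 4 = cis (theta \<Theta>) ^ 2" "?cis 1 2 2 4 = cis (theta \<Theta>)" "?cis 1 2 2 3 = inverse (cis (theta \<Theta>))"
    "?cis 1 3 3 4 = cis (theta \<Theta>)" "?cis 1 3 2 4 = 1" "?cis 1 3 2 3 = inverse (cis (theta \<Theta>))"
    "?cis 1 4 3 4 = cis (theta \<Theta>)" "?cis 1 4 2 4 = cis (theta \<Theta>)" "?cis 1 4 2 3 = 1"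
    unfolding e2 by (simp_all add: gen_form_def diag_0[OF antisym] Theta_eq)
  show ?thesis
    unfolding commutation_rels_def Let_def e twisted_comm_same(1,2) free_star_gen
    by (simp only: UN_insert UN_empty Un_empty_right case_prod_conv Un_assoc c flip: comm_rels_twisted_comm)
qed

lemma commutation_rels_cases:
  "r \<in> commutation_rels (theta \<Theta>) \<Longrightarrow> \<exists>\<mu> \<nu> \<rho> \<sigma>. r = twisted_comm \<Theta> \<mu> \<nu> \<rho> \<sigma>"
  unfolding commutation_rels_eq by blast

lemma twisted_comm_in_ideal:
  assumes I: "ideal I Free" and sub: "commutation_rels (theta \<Theta>) \<subseteq> I"
  shows "twisted_comm \<Theta> \<mu> \<nu> \<rho> \<sigma> \<in> I"
proof -
  have swap: "twisted_comm \<Theta> \<rho> \<sigma> \<mu> \<nu> \<in> I" if "twisted_comm \<Theta> \<mu> \<nu> \<rho> \<sigma> \<in> I" for \<mu> \<nu> \<rho> \<sigma>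
    unfolding twisted_comm_swap[of \<rho> \<sigma>] using that
    by (intro Free_ideal_uminus[OF I] Free_ideal_closed(5)[OF I])
  have diag: "twisted_comm \<Theta> \<mu> \<mu> \<rho> \<sigma> \<in> I" "twisted_comm \<Theta> \<mu> \<nu> \<nu> \<mu> \<in> I" for \<mu> \<nu> \<rho> \<sigma>
    using sub unfolding commutation_rels_eq by blast+
  have same: "twisted_comm \<Theta> \<mu> \<nu> \<mu> \<nu> \<in> I" for \<mu> \<nu>
    by (simp add: twisted_comm_same Free_ideal_closed(1)[OF I])
  note off = sub[unfolded commutation_rels_eq UN_insert case_prod_conv Un_subset_iff insert_subset]
  \<comment> \<open>Of the 256 index quadruples each is listed, has a diagonal entry, pairs an entry
    with itself or its adjoint, or becomes one of these after interchanging the two factors.\<close>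
  have "\<forall>\<mu> \<nu> \<rho> \<sigma>. twisted_comm \<Theta> \<mu> \<nu> \<rho> \<sigma> \<in> I"
    unfolding forall_4
    by (intro conjI; (simp only: off diag same | (rule swap, simp only: off diag same)))
  then show ?thesis by blast
qed

end

end

section \<open>Idempotence recovered from the projection relations\<close>

context
  fixes J :: "free set"
  assumes sub: "projection_rels \<subseteq> J" and comm: "\<And>\<mu> \<rho> \<sigma>. comm_gen \<mu> \<mu> \<rho> \<sigma> \<in> J"
    "\<And>\<mu> \<nu>. comm_gen \<mu> \<nu> \<nu> \<mu> \<in> J"
    and J: "ideal J Free" and J_star: "\<And>p. p \<in> J \<Longrightarrow> p\<^sup>\<star> \<in> J"
begin

text \<open>The adjoint of a listed minor gives the one with \<open>\<mu>\<close> and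
  \<open>\<nu>\<close> interchanged, once the diagonal entry is moved to the front. If
  \<open>\<rho>\<close> is one of the two, the minor is a commutator with a diagonal entry or
  zero.\<close>

lemma minor_rel_in_ideal:
  assumes "\<mu> \<noteq> \<nu>" shows "minor_rel \<mu> \<rho> \<nu> \<in> J"
proof -
  have swap: "minor_rel \<nu> \<rho> \<mu> \<in> J" if "minor_rel \<mu> \<rho> \<nu> \<in> J" for \<mu> \<rho> \<nu>
    using Free_ideal_closed(2)[OF J J_star[OF that] comm(1)[of \<rho> \<nu> \<mu>]]
    by (simp add: star_diff star_mult free_star_gen)
  have same: "minor_rel \<mu> \<mu> \<nu> \<in> J" "minor_rel \<mu> \<nu> \<nu> \<in> J" for \<mu> \<nu>
    using comm(1)[of \<nu> \<mu> \<nu>] Free_ideal_closed(1)[OF J] by simp_all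
  note off = sub[unfolded projection_rels_eq Un_subset_iff insert_subset]
  have "\<forall>\<mu> \<nu>. \<mu> \<noteq> \<nu> \<longrightarrow> (\<forall>\<rho>. minor_rel \<mu> \<rho> \<nu> \<in> J)"
    unfolding forall_4
    by (intro conjI; (simp only: not_True_eq_False simp_thms | intro impI conjI;
          (simp only: off same | (rule swap, simp only: off same))))
  then show ?thesis using assms by blast
qed

text \<open>Off the diagonal, summing the minors over \<open>\<rho>\<close> turns the trace relation
  times \<open>gen \<mu> \<nu>\<close> into the entry of \<open>Q^2 - Q\<close>. The diagonal
  entries are explicit linear combinations.\<close>

lemma idem_rel_in_ideal: "idem_rel \<mu> \<nu> \<in> J"
proof (cases "\<mu> = \<nu>")
  case False
  have "(\<Sum>\<rho>\<in>UNIV. minor_rel \<mu> \<rho> \<nu>) \<in> J"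
    by (rule Free_ideal_sum[OF J minor_rel_in_ideal[OF False]])
  moreover have "trace_rel * gen \<mu> \<nu> \<in> J"
    using sub by (intro Free_ideal_closed(4)[OF J]) (auto simp: projection_rels_eq trace_diag_rels_def)
  moreover have "idem_rel \<mu> \<nu> = trace_rel * gen \<mu> \<nu> - (\<Sum>\<rho>\<in>UNIV. minor_rel \<mu> \<rho> \<nu>)"
    by (simp add: sum_subtractf left_diff_distrib sum_distrib_right)
  ultimately show ?thesis
    using Free_ideal_diff[OF J] by simp
next
  case True
  let ?D0 = "gen 1 1 - gen 1 1 * gen 1 1 - (gen 2 1 * gen 1 2 + gen 3 1 * gen 1 3 + gen 4 1 * gen 1 4)"
  let ?D1 = "gen 2 1 * gen 1 2 - gen 4 3 * gen 3 4 - (gen 1 1 * gen 2 2 - gen 3 3 * gen 4 4)"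
  let ?D2 = "gen 3 1 * gen 1 3 - gen 4 2 * gen 2 4 - (gen 1 1 * gen 3 3 - gen 2 2 * gen 4 4)"
  let ?D3 = "gen 4 1 * gen 1 4 - gen 3 2 * gen 2 3 - (gen 1 1 * gen 4 4 - gen 2 2 * gen 3 3)"
  note D = sub[unfolded projection_rels_eq trace_diag_rels_def Un_subset_iff insert_subset]
  have t: "gen \<mu> \<mu> * trace_rel \<in> J" for \<mu>
    using D by (intro Free_ideal_closed(3)[OF J]) simp
  have D0: "?D0 \<in> J" and D1: "?D1 \<in> J" and D2: "?D2 \<in> J" and D3: "?D3 \<in> J" using D by simp_all
  note intros = Free_ideal_closed(2)[OF J] Free_ideal_diff[OF J]
  have "comm_gen 1 2 2 1 + comm_gen 1 3 3 1 + comm_gen 1 4 4 1 - ?D0 \<in> J"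
    by (rule intros comm D0)+
  moreover have "comm_gen 1 2 2 1 + comm_gen 1 3 3 1 + comm_gen 1 4 4 1 - ?D0 = idem_rel 1 1"
    by (simp add: sum_4)
  ultimately have 1: "idem_rel 1 1 \<in> J" by simp
  \<comment> \<open>The second diagonal entry requires \<open>X + V + W = b(1 - b)\<close>.
    Subtracting \<open>Y - V\<close> and \<open>Z - W\<close> from \<open>X + Y + Z\<close> produces
    the left side, and the trace relation turns the resulting \<open>ab + bc + bd\<close> into
    \<open>b(1 - b)\<close>. The third and fourth entries are obtained likewise.\<close>
  have "comm_gen 2 3 3 2 + comm_gen 2 4 4 2 + gen 2 2 * trace_rel - comm_gen 2 2 1 1 - ?D0 - ?D2 - ?D3
      - gen 1 1 * trace_rel \<in> J"
    by (rule intros comm t D0 D2 D3)+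
  moreover have "comm_gen 2 3 3 2 + comm_gen 2 4 4 2 + gen 2 2 * trace_rel - comm_gen 2 2 1 1 - ?D0 - ?D2 - ?D3
      - gen 1 1 * trace_rel = idem_rel 2 2"
    by (simp add: sum_4 algebra_simps)
  ultimately have 2: "idem_rel 2 2 \<in> J" by simp
  have "comm_gen 3 4 4 3 + gen 3 3 * trace_rel - comm_gen 3 3 1 1 - comm_gen 3 3 2 2 - ?D0 - ?D1 - ?D3
      - gen 1 1 * trace_rel \<in> J"
    by (rule intros comm t D0 D1 D3)+
  moreover have "comm_gen 3 4 4 3 + gen 3 3 * trace_rel - comm_gen 3 3 1 1 - comm_gen 3 3 2 2 - ?D0 - ?D1 - ?D3
      - gen 1 1 * trace_rel = idem_rel 3 3"
    by (simp add: sum_4 algebra_simps)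
  ultimately have 3: "idem_rel 3 3 \<in> J" by simp
  have "gen 4 4 * trace_rel - comm_gen 4 4 1 1 - comm_gen 4 4 2 2 - comm_gen 4 4 3 3 - ?D0 - ?D1 - ?D2
      - gen 1 1 * trace_rel \<in> J"
    by (rule intros comm t D0 D1 D2)+
  moreover have "gen 4 4 * trace_rel - comm_gen 4 4 1 1 - comm_gen 4 4 2 2 - comm_gen 4 4 3 3 - ?D0 - ?D1 - ?D2
      - gen 1 1 * trace_rel = idem_rel 4 4"
    by (simp add: sum_4 algebra_simps)
  ultimately have 4: "idem_rel 4 4 \<in> J" by simp
  have "\<forall>\<mu>. idem_rel \<mu> \<mu> \<in> J"
    unfolding forall_4 using 1 2 3 4 by blast
  then show ?thesis using True by blast
qed

end

section \<open>Comparison of the classical and the twisted ideal\<close>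

context
  fixes \<Theta> :: "real ^ 4 ^ 4" and E :: "free set"
  assumes antisym: "\<And>\<mu> \<nu>. \<Theta> $ \<nu> $ \<mu> = - \<Theta> $ \<mu> $ \<nu>"
    and rows: "\<And>\<mu>. (\<Sum>\<nu>\<in>UNIV. \<Theta> $ \<mu> $ \<nu>) = 0"
    and cols: "\<And>\<nu>. (\<Sum>\<mu>\<in>UNIV. \<Theta> $ \<mu> $ \<nu>) = 0"
    and theta_A: "theta_A \<Theta> = - (1 / 2) * theta \<Theta>"
    and theta_B: "theta_B \<Theta> = - (1 / 2) * theta \<Theta>"
    and E: "E \<subseteq> minus_rels"
begin

text \<open>Both algebras are treated at once: \<open>E\<close> is empty for the first and
  \<open>minus_rels\<close> for the second. Commutators go to twisted commutators up to a phase, and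
  every other generating relation is an eigenvector, so membership in the opposite ideal
  suffices.\<close>

lemma star_ideal_twist_iff:
  "p \<in> star_ideal Free (projection_rels \<union> E \<union> commutation_rels (theta \<Theta>)) \<longleftrightarrow>
    phase_map (word_phase \<Theta>) p \<in> star_ideal Free (CP3_rels \<union> E)"
  (is "p \<in> ?J \<longleftrightarrow> _ \<in> ?K")
proof (rule phase_map_star_ideal_iff[where \<gamma> = "word_phase \<Theta>" and F = "cocycle \<Theta>"])
  show "word_phase \<Theta> (v + w) = word_phase \<Theta> v * word_phase \<Theta> w * cocycle \<Theta> (weight v) (weight w)" for v w
    by (rule word_phase_plus[OF antisym rows cols])
  show "word_phase \<Theta> (word_star w) = cnj (word_phase \<Theta> w)" for w
    by (rule word_phase_star[OF antisym])
  have J: "ideal ?J Free" and K: "ideal ?K Free"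
    by (rule ideal_star_ideal)+
  have K_CP3: "K_CP3 \<subseteq> ?K"
    by (rule star_ideal_mono) simp
  have eigen_E: "eigen \<Theta> 1 1 r" if "r \<in> E" for r
    using E eigen_minus_rels[OF antisym] that by blast
  have "(\<exists>a. homog a s) \<and> phase_map (word_phase \<Theta>) s \<in> ?K"
    if s: "s \<in> projection_rels \<union> E \<union> commutation_rels (theta \<Theta>)" for s
  proof -
    consider "s \<in> projection_rels" | "s \<in> E" | "s \<in> commutation_rels (theta \<Theta>)"
      using s by blast
    then show ?thesis
    proof cases
      case 1
      then show ?thesis
        using eigen_projection_rels[OF antisym 1] eigen_phase_map[OF _ K, of _ _ _ s]
          K_CP3_projection_rels K_CP3 by blast
    next
      case 2
      then show ?thesis
        using eigen_E[OF 2] eigen_phase_map[OF _ K, of _ _ _ s] star_ideal_gen[of s "CP3_rels \<union> E"] by blast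
    next
      case 3
      then obtain \<mu> \<nu> \<rho> \<sigma> where s: "s = twisted_comm \<Theta> \<mu> \<nu> \<rho> \<sigma>"
        using commutation_rels_cases[OF antisym rows theta_A theta_B] by blast
      have "comm_gen \<mu> \<nu> \<rho> \<sigma> \<in> ?K"
        using K_CP3 K_CP3_commute by blast
      then show ?thesis
        unfolding s phase_map_twisted_comm[OF antisym]
        using homog_comm(2)Free_ideal_closed(5)[OF K] by blast
    qed
  qed
  then show "\<And>s. s \<in> projection_rels \<union> E \<union> commutation_rels (theta \<Theta>) \<Longrightarrow> \<exists>a. homog a s"
    "\<And>s. s \<in> projection_rels \<union> E \<union> commutation_rels (theta \<Theta>) \<Longrightarrow> phase_map (word_phase \<Theta>) s \<in> ?K"
    by blast+
  have tcomm: "twisted_comm \<Theta> \<mu> \<nu> \<rho> \<sigma> \<in> ?J" for \<mu> \<nu> \<rho> \<sigma>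
    by (rule twisted_comm_in_ideal[OF antisym rows theta_A theta_B J]) (auto intro: star_ideal_gen)
  have comm: "comm_gen \<mu> \<mu> \<rho> \<sigma> \<in> ?J" "comm_gen \<mu> \<nu> \<nu> \<mu> \<in> ?J" for \<mu> \<nu> \<rho> \<sigma>
    using tcomm[of \<mu> \<mu> \<rho> \<sigma>] tcomm[of \<mu> \<nu> \<nu> \<mu>] by (simp_all only: twisted_comm_same[OF antisym])
  have proj: "projection_rels \<subseteq> ?J"
    by (auto intro: star_ideal_gen)
  have "(\<exists>a. homog a r) \<and> phase_map (\<lambda>w. inverse (word_phase \<Theta> w)) r \<in> ?J"
    if "r \<in> CP3_rels \<union> E" for r
  proof -
    consider \<mu> \<nu> \<rho> \<sigma> where "r = comm_gen \<mu> \<nu> \<rho> \<sigma>" | \<mu> \<nu> where "eigen \<Theta> \<mu> \<nu> r" "r \<in> ?J"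
    proof -
      have "idem_rel \<mu> \<nu> \<in> ?J" for \<mu> \<nu>
        by (rule idem_rel_in_ideal[OF proj comm J star_ideal_star])
      moreover have "trace_rel \<in> ?J"
        using proj by (auto simp: projection_rels_eq trace_diag_rels_def)
      moreover have "r \<in> ?J" if "r \<in> E"
        using that by (auto intro: star_ideal_gen)
      ultimately show ?thesis
        using that \<open>r \<in> CP3_rels \<union> E\<close> eigen_idem_rel[OF antisym] eigen_trace_rel[OF antisym] eigen_E
        unfolding Un_iff CP3_rels_iff by blast
    qed
    then show ?thesis
    proof cases
      case 1
      then show ?thesis
        using phase_map_comm_gen[OF antisym] homog_comm(1)Free_ideal_closed(5)[OF J tcomm] by metis
    next
      case 2
      then show ?thesis
        using eigen_phase_map[OF 2(1) J 2(2)] by blast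
    qed
  qed
  then show "\<And>r. r \<in> CP3_rels \<union> E \<Longrightarrow> \<exists>a. homog a r"
    "\<And>r. r \<in> CP3_rels \<union> E \<Longrightarrow> phase_map (\<lambda>w. inverse (word_phase \<Theta> w)) r \<in> ?J"
    by blast+
qed simp

lemma free_surj_twist:
  assumes "free_surj \<psi> A (star_ideal Free (CP3_rels \<union> E))"
  shows "free_surj (\<lambda>p. \<psi> (phase_map (word_phase \<Theta>) p)) (twist (cocycle \<Theta>) A (\<lambda>\<alpha>. \<psi> ` Free_grading \<alpha>))
    (star_ideal Free (projection_rels \<union> E \<union> commutation_rels (theta \<Theta>)))"
  by (rule free_surj.twist[OF assms, where \<gamma> = "word_phase \<Theta>"])
    (simp_all add: word_phase_plus[OF antisym rows cols] word_phase_star[OF antisym] ideal_star_ideal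
      star_ideal_twist_iff)

end

section \<open>Transfer to the quantised algebras\<close>

lemma free_surj_CP3: "free_surj (quot_class Free CP3_rels) CP3 (star_ideal Free CP3_rels)"
  unfolding CP3_def by (rule free_surj_quot)

lemma free_surj_CP3_minus:
  "free_surj (\<lambda>p. quot_class CP3 CP3_minus_rels (quot_class Free CP3_rels p)) CP3_minus
    (star_ideal Free (CP3_rels \<union> minus_rels))"
proof -
  interpret free_surj "quot_class Free CP3_rels" CP3 "star_ideal Free CP3_rels"
    by (rule free_surj_CP3)
  have "CP3_minus_rels = quot_class Free CP3_rels ` minus_rels"
    by (simp add: CP3_minus_rels_def minus_rels_eq Q_def mult minus)
  from quot_by[OF _ this, of "CP3_rels \<union> free_star ` CP3_rels"] show ?thesis
    by (simp add: CP3_minus_def star_ideal_def image_Un Un_ac)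
qed

lemma phase_map_word_phase_gen:
  "phase_map (word_phase \<Theta>) (gen \<mu> \<nu>) = exp (- \<i> * complex_of_real (\<Theta> $ \<mu> $ \<nu>)) *\<^sub>C gen \<mu> \<nu>"
  by (simp add: phase_map_gen cis_conv_exp)

theorem proposition6p5:
  fixes \<Theta> :: "real ^ 4 ^ 4"
  assumes antisym: "\<And>\<mu> \<nu>. \<Theta> $ \<nu> $ \<mu> = - \<Theta> $ \<mu> $ \<nu>"
    and rows: "\<And>\<mu>. (\<Sum>\<nu>\<in>UNIV. \<Theta> $ \<mu> $ \<nu>) = 0"
    and cols: "\<And>\<nu>. (\<Sum>\<mu>\<in>UNIV. \<Theta> $ \<mu> $ \<nu>) = 0"
    and "theta_A \<Theta> = - (1 / 2) * theta \<Theta>"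
    and "theta_B \<Theta> = - (1 / 2) * theta \<Theta>"
  shows "has_presentation (CP3_F \<Theta>) (Qhat \<Theta>)
           (projection_rels \<union> commutation_rels (theta \<Theta>))
       \<and> has_presentation (CP3_minus_F \<Theta>) (Qhat_minus \<Theta>)
           (projection_rels \<union> minus_rels \<union> commutation_rels (theta \<Theta>))
       \<and> (let A = CP3_minus_F \<Theta>; b = Qhat_minus \<Theta> 2 2; c = Qhat_minus \<Theta> 3 3;
             d = Qhat_minus \<Theta> 4 4; w = Qhat_minus \<Theta> 2 3; v = Qhat_minus \<Theta> 2 4;
             u = Qhat_minus \<Theta> 3 4
         in star A u \<otimes>\<^bsub>A\<^esub> u = c \<otimes>\<^bsub>A\<^esub> d \<and> star A v \<otimes>\<^bsub>A\<^esub> v = b \<otimes>\<^bsub>A\<^esub> d \<and>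
            star A w \<otimes>\<^bsub>A\<^esub> w = b \<otimes>\<^bsub>A\<^esub> c)"
proof -
  let ?T = "phase_map (word_phase \<Theta>)"
  let ?\<psi> = "\<lambda>p. quot_class CP3 CP3_minus_rels (quot_class Free CP3_rels (?T p))"
  let ?J = "star_ideal Free (projection_rels \<union> minus_rels \<union> commutation_rels (theta \<Theta>))"
  have CP3_F: "free_surj (\<lambda>p. quot_class Free CP3_rels (?T p)) (CP3_F \<Theta>)
      (star_ideal Free (projection_rels \<union> commutation_rels (theta \<Theta>)))"
    using free_surj_twist[OF antisym rows cols assms(4,5), of "{}"] free_surj_CP3
    by (simp add: CP3_F_def CP3_grading_def[abs_def])
  \<comment> \<open>The phase of a one-letter word is precisely the normalising factor, so the new
    surjection sends the free generators to \<open>Qhat\<close>.\<close>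
  have Qhat: "Qhat \<Theta> = (\<lambda>\<mu> \<nu>. quot_class Free CP3_rels (?T (gen \<mu> \<nu>)))"
    using free_surj.smult[OF free_surj_CP3]
    by (simp add: fun_eq_iff Qhat_def CP3_F_def twist_def Q_def phase_map_word_phase_gen)
  have minus: "free_surj ?\<psi> (CP3_minus_F \<Theta>) ?J"
    using free_surj_twist[OF antisym rows cols assms(4,5), of minus_rels] free_surj_CP3_minus
    by (simp add: CP3_minus_F_def CP3_minus_grading_def[abs_def] CP3_grading_def image_image)
  have Qhat_minus: "Qhat_minus \<Theta> = (\<lambda>\<mu> \<nu>. ?\<psi> (gen \<mu> \<nu>))"
    using free_surj.smult[OF free_surj_CP3_minus]
    by (simp add: fun_eq_iff Qhat_minus_def CP3_minus_F_def twist_def Q_minus_def Q_def phase_map_word_phase_gen)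
  interpret minus: free_surj ?\<psi> "CP3_minus_F \<Theta>" ?J
    by (rule minus)
  have J: "r \<in> ?J" if "r \<in> projection_rels \<union> minus_rels" for r
    using that by (auto intro: star_ideal_gen)
  have diff: "p - q \<in> ?J" if "p \<in> projection_rels \<union> minus_rels" "q \<in> projection_rels \<union> minus_rels" for p q
    by (rule Free_ideal_diff[OF ideal_star_ideal]; rule J; rule that)
  \<comment> \<open>\<open>U = cd\<close> is the difference of \<open>X = ab\<close> and
    \<open>X - U = ab - cd\<close>; \<open>V\<close> and \<open>W\<close> are treated in the same
    way.\<close>
  have rels: "gen 4 3 * gen 3 4 - gen 3 3 * gen 4 4 \<in> ?J" "gen 4 2 * gen 2 4 - gen 2 2 * gen 4 4 \<in> ?J"
    "gen 3 2 * gen 2 3 - gen 2 2 * gen 3 3 \<in> ?J"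
    using diff[of "gen 2 1 * gen 1 2 - gen 1 1 * gen 2 2"
        "gen 2 1 * gen 1 2 - gen 4 3 * gen 3 4 - (gen 1 1 * gen 2 2 - gen 3 3 * gen 4 4)"]
      diff[of "gen 3 1 * gen 1 3 - gen 1 1 * gen 3 3"
        "gen 3 1 * gen 1 3 - gen 4 2 * gen 2 4 - (gen 1 1 * gen 3 3 - gen 2 2 * gen 4 4)"]
      diff[of "gen 4 1 * gen 1 4 - gen 1 1 * gen 4 4"
        "gen 4 1 * gen 1 4 - gen 3 2 * gen 2 3 - (gen 1 1 * gen 4 4 - gen 2 2 * gen 3 3)"]
    by (simp_all add: projection_rels_eq trace_diag_rels_def minus_rels_eq)
  show ?thesis
    using free_surj_has_presentation[OF CP3_F] free_surj_has_presentation[OF minus] rels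
    by (simp add: Qhat Qhat_minus Let_def minus.star minus.mult minus.eq_iff free_star_gen)
qed

end
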